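(* Consider the $187$ triangulations (up to isomorphism) of the Klein bottle with exactly $9$ vertices. At least $90$ of them are polyhedrally realizable in $\mathbb{R}^3$. At least $11$ of them possess polyhedral realizations in $\mathbb{R}^3$ with a $2$-fold rotational symmetry.
   Context: A triangulation of a closed connected surface $S$ is a finite two-dimensional simplicial complex $\Delta$ whose underlying space $|\Delta|$ is homeomorphic to $S$; triangulations are counted up to combinatorial (simplicial) isomorphism. The Klein bottle has exactly $187$ triangulations with $9$ vertices, from the known enumeration. Let $V$ be the vertex set of $\Delta$. Each map $\psi\colon V\to\mathbb{R}^3$ induces a simplexwise linear map $\phi_\psi\colon|\Delta|\to\mathbb{R}^3$. Since the surface is non-orientable, a polyhedral realization of $\Delta$ in $\mathbb{R}^3$ is a map $\phi_\psi$ that is locally injective (a simplexwise linear immersion); $\Delta$ is polyhedrally realizable if such a $\psi$ exists. A geometric symmetry of a polyhedral realization $\phi_\psi$ is an isometry $g$ of $\mathbb{R}^3$ that maps $\phi_\psi(|\Delta|)$ to itself and is induced by an automorphism $\alpha$ of $\Delta$, i.e. $g\circ\phi_\psi=\phi_\psi\circ|\alpha|$. The realization has $2$-fold rotational symmetry if a rotation of order $2$ about a line is a geometric symmetry of it, induced by a nontrivial automorphism. *)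

theory Defs
  imports "HOL-Analysis.Analysis"
begin

section \<open>Abstract simplicial complexes and their isomorphisms\<close>

text \<open>A complex is given by its set of nonempty faces. (\<open>simplicial_complex\<close> of
  HOL-Analysis is about geometric complexes, embedded in a Euclidean space.)\<close>

definition abstract_complex :: "'v set set \<Rightarrow> bool" where
  "abstract_complex \<Delta> \<longleftrightarrow>
     finite \<Delta> \<and> (\<forall>\<sigma>\<in>\<Delta>. finite \<sigma> \<and> \<sigma> \<noteq> {}) \<and>
     (\<forall>\<sigma>\<in>\<Delta>. \<forall>\<tau>. \<tau> \<subseteq> \<sigma> \<and> \<tau> \<noteq> {} \<longrightarrow> \<tau> \<in> \<Delta>)"

definition two_dimensional :: "'v set set \<Rightarrow> bool" where
  "two_dimensional \<Delta> \<longleftrightarrow> (\<forall>\<sigma>\<in>\<Delta>. card \<sigma> \<le> 3) \<and> (\<exists>\<sigma>\<in>\<Delta>. card \<sigma> = 3)"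

definition vertices :: "'v set set \<Rightarrow> 'v set" where
  "vertices \<Delta> = \<Union>\<Delta>"

definition complex_iso :: "'v set set \<Rightarrow> 'w set set \<Rightarrow> ('v \<Rightarrow> 'w) \<Rightarrow> bool" where
  "complex_iso \<Delta> \<Delta>' f \<longleftrightarrow>
     bij_betw f (vertices \<Delta>) (vertices \<Delta>') \<and> (\<lambda>\<sigma>. f ` \<sigma>) ` \<Delta> = \<Delta>'"

definition isomorphic_complexes :: "'v set set \<Rightarrow> 'w set set \<Rightarrow> bool" where
  "isomorphic_complexes \<Delta> \<Delta>' \<longleftrightarrow> (\<exists>f. complex_iso \<Delta> \<Delta>' f)"

abbreviation complex_automorphism :: "'v set set \<Rightarrow> ('v \<Rightarrow> 'v) \<Rightarrow> bool" where
  "complex_automorphism \<Delta> \<alpha> \<equiv> complex_iso \<Delta> \<Delta> \<alpha>"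


section \<open>Underlying space\<close>

text \<open>Points of the underlying space are given by their barycentric coordinates. For a finite
  complex its usual topology is the one inherited from the product topology on functions.\<close>

definition underlying_space :: "'v set set \<Rightarrow> ('v \<Rightarrow> real) set" where
  "underlying_space \<Delta> =
     {x. (\<forall>v. 0 \<le> x v) \<and> {v. x v \<noteq> 0} \<in> \<Delta> \<and> (\<Sum>v\<in>vertices \<Delta>. x v) = 1}"

text \<open>The action on the underlying space of the simplicial map with vertex map \<open>\<alpha>\<close>.\<close>

definition induced_map ::
    "'v set set \<Rightarrow> ('v \<Rightarrow> 'w) \<Rightarrow> ('v \<Rightarrow> real) \<Rightarrow> ('w \<Rightarrow> real)" where
  "induced_map \<Delta> \<alpha> x = (\<lambda>w. \<Sum>v | v \<in> vertices \<Delta> \<and> \<alpha> v = w. x v)"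


section \<open>The Klein bottle\<close>

definition quotient_topology :: "'a topology \<Rightarrow> ('a \<times> 'a) set \<Rightarrow> 'a set topology" where
  "quotient_topology X R =
     topology (\<lambda>U. U \<subseteq> topspace X // R \<and> openin X (\<Union>U))"

lemma openin_quotient_topology:
  assumes R: "equiv (topspace X) R"
  shows "openin (quotient_topology X R) U \<longleftrightarrow> U \<subseteq> topspace X // R \<and> openin X (\<Union>U)"
proof -
  have Int: "\<Union>(S \<inter> T) = \<Union>S \<inter> \<Union>T"
    if "S \<subseteq> topspace X // R" "T \<subseteq> topspace X // R" for S T
    using that quotient_disj[OF R] by blast
  have Un: "openin X (\<Union>(\<Union>K))" if "\<forall>U\<in>K. openin X (\<Union>U)" for K :: "'a set set set"
  proof -
    have "\<Union>(\<Union>K) = \<Union>(Union ` K)" by blast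
    with that show ?thesis by (metis (mono_tags, lifting) imageE openin_Union)
  qed
  have "istopology (\<lambda>U. U \<subseteq> topspace X // R \<and> openin X (\<Union>U))"
    unfolding istopology_def
  proof (intro conjI allI impI; (elim conjE)?)
    fix S T
    assume "S \<subseteq> topspace X // R" "openin X (\<Union>S)" "T \<subseteq> topspace X // R" "openin X (\<Union>T)"
    then show "S \<inter> T \<subseteq> topspace X // R" "openin X (\<Union>(S \<inter> T))"
      using Int[of S T] by (auto simp: openin_Int)
  next
    fix K
    assume "\<forall>U\<in>K. U \<subseteq> topspace X // R \<and> openin X (\<Union>U)"
    then show "\<Union>K \<subseteq> topspace X // R" "openin X (\<Union>(\<Union>K))"
      using Un[of K] by auto
  qed
  then show ?thesis
    unfolding quotient_topology_def by simp
qed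

abbreviation unit_square :: "(real \<times> real) set" where
  "unit_square \<equiv> {0..1} \<times> {0..1}"

definition klein_gluing :: "((real \<times> real) \<times> (real \<times> real)) set" where
  "klein_gluing =
     {((0, y), (1, y)) | y. y \<in> {0..1}} \<union> {((x, 0), (1 - x, 1)) | x. x \<in> {0..1}}"

text \<open>The equivalence relation on the unit square generated by the gluing.\<close>

definition klein_rel :: "((real \<times> real) \<times> (real \<times> real)) set" where
  "klein_rel = (klein_gluing \<union> klein_gluing\<inverse>)\<^sup>* \<inter> unit_square \<times> unit_square"

lemma equiv_klein_rel: "equiv unit_square klein_rel"
proof (rule equivI)
  show "klein_rel \<subseteq> unit_square \<times> unit_square" "refl_on unit_square klein_rel"
    by (auto simp: klein_rel_def refl_on_def)
  have "sym ((klein_gluing \<union> klein_gluing\<inverse>)\<^sup>*)"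
    by (intro sym_rtrancl sym_Un_converse)
  then show "sym klein_rel"
    by (auto simp: klein_rel_def sym_def)
  show "trans klein_rel"
    unfolding klein_rel_def trans_def by (blast intro: rtrancl_trans)
qed

definition klein_bottle :: "(real \<times> real) set topology" where
  "klein_bottle = quotient_topology (top_of_set unit_square) klein_rel"

definition klein_bottle_triangulation :: "'v set set \<Rightarrow> bool" where
  "klein_bottle_triangulation \<Delta> \<longleftrightarrow>
     abstract_complex \<Delta> \<and> two_dimensional \<Delta> \<and>
     top_of_set (underlying_space \<Delta>) homeomorphic_space klein_bottle"

text \<open>Triangulations of the Klein bottle with \<open>n\<close> vertices, labelled by \<open>0, \<dots>, n - 1\<close>;
  the (unlabelled) triangulations are the isomorphism classes of these.\<close>

definition klein_bottle_triangulations :: "nat \<Rightarrow> nat set set set" where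
  "klein_bottle_triangulations n =
     {\<Delta>. klein_bottle_triangulation \<Delta> \<and> vertices \<Delta> = {..<n}}"

definition klein_bottle_triangulation_classes :: "nat \<Rightarrow> nat set set set set" where
  "klein_bottle_triangulation_classes n =
     klein_bottle_triangulations n //
       {(\<Delta>, \<Delta>'). \<Delta> \<in> klein_bottle_triangulations n \<and> \<Delta>' \<in> klein_bottle_triangulations n \<and>
                 isomorphic_complexes \<Delta> \<Delta>'}"


section \<open>Polyhedral realizations\<close>

definition simplexwise_linear ::
    "'v set set \<Rightarrow> ('v \<Rightarrow> real^3) \<Rightarrow> ('v \<Rightarrow> real) \<Rightarrow> real^3" where
  "simplexwise_linear \<Delta> \<psi> x = (\<Sum>v\<in>vertices \<Delta>. x v *\<^sub>R \<psi> v)"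

definition locally_injective :: "'a topology \<Rightarrow> ('a \<Rightarrow> 'b) \<Rightarrow> bool" where
  "locally_injective X f \<longleftrightarrow> (\<forall>x\<in>topspace X. \<exists>U. openin X U \<and> x \<in> U \<and> inj_on f U)"

definition polyhedral_realization :: "'v set set \<Rightarrow> ('v \<Rightarrow> real^3) \<Rightarrow> bool" where
  "polyhedral_realization \<Delta> \<psi> \<longleftrightarrow>
     locally_injective (top_of_set (underlying_space \<Delta>)) (simplexwise_linear \<Delta> \<psi>)"

definition polyhedrally_realizable :: "'v set set \<Rightarrow> bool" where
  "polyhedrally_realizable \<Delta> \<longleftrightarrow> (\<exists>\<psi>. polyhedral_realization \<Delta> \<psi>)"


section \<open>Geometric symmetries\<close>

definition isometry_of_space :: "(real^3 \<Rightarrow> real^3) \<Rightarrow> bool" where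
  "isometry_of_space g \<longleftrightarrow> bij g \<and> (\<forall>x y. dist (g x) (g y) = dist x y)"

definition geometric_symmetry_induced_by ::
    "'v set set \<Rightarrow> ('v \<Rightarrow> real^3) \<Rightarrow> (real^3 \<Rightarrow> real^3) \<Rightarrow> ('v \<Rightarrow> 'v) \<Rightarrow> bool" where
  "geometric_symmetry_induced_by \<Delta> \<psi> g \<alpha> \<longleftrightarrow>
     isometry_of_space g \<and>
     g ` simplexwise_linear \<Delta> \<psi> ` underlying_space \<Delta>
       = simplexwise_linear \<Delta> \<psi> ` underlying_space \<Delta> \<and>
     complex_automorphism \<Delta> \<alpha> \<and>
     (\<forall>x\<in>underlying_space \<Delta>.
        g (simplexwise_linear \<Delta> \<psi> x) = simplexwise_linear \<Delta> \<psi> (induced_map \<Delta> \<alpha> x))"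

text \<open>A rotation about the line through \<open>a\<close> in direction \<open>d\<close>.\<close>

definition rotation_about_line :: "(real^3 \<Rightarrow> real^3) \<Rightarrow> real^3 \<Rightarrow> real^3 \<Rightarrow> bool" where
  "rotation_about_line g a d \<longleftrightarrow>
     d \<noteq> 0 \<and> (\<exists>Q. rotation_matrix Q \<and> Q *v d = d \<and> g = (\<lambda>x. a + Q *v (x - a)))"

definition order_two_rotation :: "(real^3 \<Rightarrow> real^3) \<Rightarrow> bool" where
  "order_two_rotation g \<longleftrightarrow> (\<exists>a d. rotation_about_line g a d) \<and> g \<noteq> id \<and> g \<circ> g = id"

text \<open>Vertex maps matter only on the vertices, so \<open>\<alpha>\<close> is nontrivial iff it moves a vertex.\<close>

definition has_twofold_rotational_symmetry :: "'v set set \<Rightarrow> ('v \<Rightarrow> real^3) \<Rightarrow> bool" where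
  "has_twofold_rotational_symmetry \<Delta> \<psi> \<longleftrightarrow>
     (\<exists>g \<alpha>. order_two_rotation g \<and> geometric_symmetry_induced_by \<Delta> \<psi> g \<alpha> \<and>
            (\<exists>v\<in>vertices \<Delta>. \<alpha> v \<noteq> v))"

end

theory Submission
  imports Defs
begin

text \<open>
  All triangulations below arise from a \<open>3 \<times> 3\<close> grid on the unit square by edge flips. The grid is a Klein bottle because
  barycentric coordinates descend from the square to the quotient, and a flip changes the underlying space only by a
  piecewise linear homeomorphism, so no classification of surfaces is needed.

  A simplexwise linear map is locally injective iff it is injective on the star of every vertex, and this is a
  statement about pairs of triangles with a common vertex, decided by signs of determinants of integer coordinates.

  Isomorphism classes are told apart by one number, obtained by weighting each vertex with the degrees of the vertices
  around it and summing over the triangles.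
\<close>

text \<open>Both claims are lower bounds on a number of classes, so it suffices to exhibit enough
  pairwise non-isomorphic complexes, each with coordinates. Of what has to be shown for each of
  them, only the homeomorphism type is beyond evaluation. A flip sequence is a certificate for it:
  the grid has exactly nine vertices, flips keep the vertex set, and every listed triangulation is
  at most five flips away. The rest is finite integer arithmetic.

  A closed non-orientable surface does not embed in space, so self-intersections are unavoidable and
  triangles without a common vertex may cross freely. At a vertex the condition is homogeneous:
  stars may be replaced by cones, and injectivity becomes a question on linear relations between
  edge vectors.

  The delicate point of the grid is injectivity on the quotient. The gluing reverses the top row, so
  the two coordinates of a point cannot be recovered independently: the height comes first, and the
  horizontal position only relative to it.\<close>

section \<open>Complexes generated by their triangles\<close>

definition complex_of :: "'v set set \<Rightarrow> 'v set set" where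
  "complex_of F = {\<sigma>. \<sigma> \<noteq> {} \<and> (\<exists>T\<in>F. \<sigma> \<subseteq> T)}"

lemma vertices_complex_of: "vertices (complex_of F) = \<Union>F"
  unfolding vertices_def complex_of_def by blast

lemma abstract_complex_complex_of:
  assumes "finite F" "\<And>T. T \<in> F \<Longrightarrow> finite T"
  shows "abstract_complex (complex_of F)"
proof -
  have "complex_of F \<subseteq> Pow (\<Union>F)" by (auto simp: complex_of_def)
  moreover have "finite (Pow (\<Union>F))" using assms by auto
  ultimately have "finite (complex_of F)" by (rule finite_subset)
  moreover have "finite \<sigma> \<and> \<sigma> \<noteq> {}" if "\<sigma> \<in> complex_of F" for \<sigma>
    using that assms by (auto simp: complex_of_def intro: finite_subset)
  moreover have "\<tau> \<in> complex_of F" if "\<sigma> \<in> complex_of F" "\<tau> \<subseteq> \<sigma>" "\<tau> \<noteq> {}" for \<sigma> \<tau>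
    using that unfolding complex_of_def by blast
  ultimately show ?thesis unfolding abstract_complex_def by blast
qed

lemma two_dimensional_complex_of:
  assumes "F \<noteq> {}" "\<And>T. T \<in> F \<Longrightarrow> card T = 3"
  shows "two_dimensional (complex_of F)"
proof -
  have "card \<sigma> \<le> 3" if \<sigma>: "\<sigma> \<in> complex_of F" for \<sigma>
  proof -
    obtain T where "T \<in> F" "\<sigma> \<subseteq> T" using \<sigma> unfolding complex_of_def by blast
    then show ?thesis using assms(2)[of T] card_mono[of T \<sigma>] card_ge_0_finite[of T] by simp
  qed
  moreover obtain T where "T \<in> F" using assms(1) by auto
  then have "T \<in> complex_of F" "card T = 3"
    using assms(2)[of T] by (auto simp: complex_of_def)
  ultimately show ?thesis unfolding two_dimensional_def by blast
qed

text \<open>Recovers the triangles from the complex alone, so that quantities defined on complexes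
  can be evaluated on lists of triangles.\<close>

lemma facets_complex_of:
  assumes "\<And>T. T \<in> F \<Longrightarrow> card T = 3"
  shows "{\<sigma> \<in> complex_of F. card \<sigma> = 3} = F"
proof -
  have "\<sigma> = T" if "T \<in> F" "\<sigma> \<subseteq> T" "card \<sigma> = 3" for \<sigma> T
    using assms[OF that(1)] that card_ge_0_finite[of T] card_subset_eq[of T \<sigma>] by simp
  moreover have "T \<noteq> {}" if "T \<in> F" for T using assms[OF that] by auto
  ultimately show ?thesis using assms unfolding complex_of_def by blast
qed

text \<open>A triangle containing the support replaces the exact support: the support is nonempty
  because the coordinates add up to 1, and every nonempty subset of a triangle is a face.\<close>

lemma underlying_space_complex_of:
  "x \<in> underlying_space (complex_of F) \<longleftrightarrow>
    (\<forall>v. 0 \<le> x v) \<and> (\<exists>T\<in>F. \<forall>v. v \<notin> T \<longrightarrow> x v = 0) \<and> (\<Sum>v\<in>\<Union>F. x v) = 1"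
proof -
  have "{v. x v \<noteq> 0} \<in> complex_of F \<longleftrightarrow> (\<exists>v. x v \<noteq> 0) \<and> (\<exists>T\<in>F. \<forall>v. v \<notin> T \<longrightarrow> x v = 0)"
    unfolding complex_of_def by blast
  moreover have "\<exists>v. x v \<noteq> 0" if "(\<Sum>v\<in>\<Union>F. x v) = 1"
    using that by (metis sum.neutral zero_neq_one)
  ultimately show ?thesis
    unfolding underlying_space_def vertices_complex_of mem_Collect_eq by meson
qed


section \<open>Edge flips\<close>

text \<open>The two triangles at the edge \<open>ac\<close> form a quadrilateral. Placing it in the plane as a parallelogram, with
  \<open>a + c = b + d\<close>, identifies it with the quadrilateral cut along \<open>bd\<close>; in barycentric coordinates, \<open>min (x a) (x c)\<close>
  units of \<open>a + c\<close> are exchanged for \<open>b + d\<close>. This is the identity off the quadrilateral.\<close>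

definition flip_map :: "'v \<Rightarrow> 'v \<Rightarrow> 'v \<Rightarrow> 'v \<Rightarrow> ('v \<Rightarrow> real) \<Rightarrow> 'v \<Rightarrow> real" where
  "flip_map a c b d x v =
     x v + min (x a) (x c) * (of_bool (v = b) + of_bool (v = d) - of_bool (v = a) - of_bool (v = c))"

lemma continuous_on_flip_map: "continuous_on S (flip_map a c b d)"
proof (rule continuous_on_coordinatewise_then_product)
  fix v
  have coord: "continuous_on S (\<lambda>x. x u)" for u :: 'a
    by (rule continuous_on_subset[OF continuous_on_product_coordinates]) simp
  show "continuous_on S (\<lambda>x. flip_map a c b d x v)"
    unfolding flip_map_def
    by (intro continuous_on_add continuous_on_mult continuous_on_min continuous_on_const coord)
qed

text \<open>As no other triangle contains the edge ac, a point with positive coordinates at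
  \<open>a\<close> and \<open>c\<close> lies in the quadrilateral. As bd is not yet an edge, the
  amount exchanged can be read off afterwards from the coordinates at \<open>b\<close> and
  \<open>d\<close>.\<close>

locale edge_flip =
  fixes a b c d :: 'v and G F F' :: "'v set set"
  assumes dist: "distinct [a, b, c, d]"
    and finite_facets: "finite G" "\<And>T. T \<in> G \<Longrightarrow> finite T"
    and F_def: "F = {{a, b, c}, {a, c, d}} \<union> G"
    and F'_def: "F' = {{b, a, d}, {b, d, c}} \<union> G"
    and not_ac: "\<And>T. T \<in> G \<Longrightarrow> \<not> (a \<in> T \<and> c \<in> T)"
    and not_bd: "\<And>T. T \<in> G \<Longrightarrow> \<not> (b \<in> T \<and> d \<in> T)"
begin

lemma same_vertices: "\<Union>F' = \<Union>F"
  by (auto simp: F_def F'_def)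

text \<open>Subtracting the minimum makes the coordinate at \<open>a\<close> or at \<open>c\<close>
  vanish, which puts the image on one side of the new diagonal bd.\<close>

lemma flip_map_in:
  assumes x: "x \<in> underlying_space (complex_of F)"
  shows "flip_map a c b d x \<in> underlying_space (complex_of F')"
proof -
  obtain T where T: "T \<in> F" "\<And>v. v \<notin> T \<Longrightarrow> x v = 0"
    and nn: "\<And>v. 0 \<le> x v" and sum1: "(\<Sum>v\<in>\<Union>F. x v) = 1"
    using x unfolding underlying_space_complex_of by blast
  let ?m = "min (x a) (x c)" and ?y = "flip_map a c b d x"
  have m0: "?m \<ge> 0" using nn by simp
  have "0 \<le> ?y v" for v
    using nn[of v] m0 dist by (auto simp: flip_map_def min_def)
  moreover have "\<exists>T\<in>F'. \<forall>v. v \<notin> T \<longrightarrow> ?y v = 0"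
  proof (cases "?m = 0")
    case True
    \<comment> \<open>Nothing is moved, but the old triangle may be gone. A point of it with
      coordinate zero at \<open>a\<close> or \<open>c\<close> lies on a boundary edge of the
      quadrilateral, hence in a new triangle.\<close>
    then have y: "?y = x" by (auto simp: flip_map_def)
    have ac: "x a = 0 \<or> x c = 0" using True by (auto simp: min_def split: if_splits)
    consider "T \<in> G" | "T = {a, b, c}" | "T = {a, c, d}" using T(1) by (auto simp: F_def)
    then show ?thesis
    proof cases
      case 1 then show ?thesis using T(2) y by (auto simp: F'_def)
    next
      case 2
      then have z: "x v = 0" if "v \<notin> {a, b, c}" for v using T(2) that by blast
      have "(\<forall>v. v \<notin> {b, d, c} \<longrightarrow> x v = 0) \<or> (\<forall>v. v \<notin> {b, a, d} \<longrightarrow> x v = 0)"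
        using ac
      proof
        assume 0: "x a = 0"
        have "x v = 0" if "v \<notin> {b, d, c}" for v using 0 z[of v] that by (cases "v = a") auto
        then show ?thesis by blast
      next
        assume 0: "x c = 0"
        have "x v = 0" if "v \<notin> {b, a, d}" for v using 0 z[of v] that by (cases "v = c") auto
        then show ?thesis by blast
      qed
      then show ?thesis unfolding y F'_def by blast
    next
      case 3
      then have z: "x v = 0" if "v \<notin> {a, c, d}" for v using T(2) that by blast
      have "(\<forall>v. v \<notin> {b, d, c} \<longrightarrow> x v = 0) \<or> (\<forall>v. v \<notin> {b, a, d} \<longrightarrow> x v = 0)"
        using ac
      proof
        assume 0: "x a = 0"
        have "x v = 0" if "v \<notin> {b, d, c}" for v using 0 z[of v] that by (cases "v = a") auto
        then show ?thesis by blast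
      next
        assume 0: "x c = 0"
        have "x v = 0" if "v \<notin> {b, a, d}" for v using 0 z[of v] that by (cases "v = c") auto
        then show ?thesis by blast
      qed
      then show ?thesis unfolding y F'_def by blast
    qed
  next
    case False
    then have "x a \<noteq> 0" "x c \<noteq> 0" using nn[of a] nn[of c] by (auto simp: min_def split: if_splits)
    then have "a \<in> T" "c \<in> T" using T(2) by auto
    then have T': "T = {a, b, c} \<or> T = {a, c, d}" using T(1) not_ac by (auto simp: F_def)
    then have zero: "x v = 0" if "v \<notin> {a, b, c, d}" for v using T(2) that by auto
    have y0: "?y v = 0" if "v \<notin> {a, b, c, d}" for v using zero[OF that] that by (auto simp: flip_map_def)
    have "?y a = x a - ?m" "?y c = x c - ?m" using dist by (auto simp: flip_map_def)
    then have ac0: "?y a = 0 \<or> ?y c = 0" by linarith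
    have "?y v = 0" if "?y a = 0" "v \<notin> {b, d, c}" for v
      using y0[of v] that by (cases "v = a") auto
    moreover have "?y v = 0" if "?y c = 0" "v \<notin> {b, a, d}" for v
      using y0[of v] that by (cases "v = c") auto
    ultimately show ?thesis using ac0 unfolding F'_def by blast
  qed
  moreover have "(\<Sum>v\<in>\<Union>F'. ?y v) = 1"
  proof -
    have fin: "finite (\<Union>F)" and mem: "a \<in> \<Union>F" "b \<in> \<Union>F" "c \<in> \<Union>F" "d \<in> \<Union>F"
      using finite_facets by (auto simp: F_def)
    have one: "(\<Sum>v\<in>\<Union>F. of_bool (v = u)) = (1::real)" if "u \<in> \<Union>F" for u
      using fin that unfolding of_bool_def by (subst sum.delta) auto
    have "(\<Sum>v\<in>\<Union>F. ?y v) = (\<Sum>v\<in>\<Union>F. x v) + ?m * (\<Sum>v\<in>\<Union>F. of_bool (v = b) + of_bool (v = d) - of_bool (v = a) - of_bool (v = c))"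
      unfolding flip_map_def by (simp add: sum.distrib sum_distrib_left)
    also have "(\<Sum>v\<in>\<Union>F. of_bool (v = b) + of_bool (v = d) - of_bool (v = a) - of_bool (v = c)) = (0::real)"
      by (simp only: sum.distrib sum_subtractf one[OF mem(1)] one[OF mem(2)] one[OF mem(3)] one[OF mem(4)])
    finally show ?thesis using sum1 same_vertices by simp
  qed
  ultimately show ?thesis unfolding underlying_space_complex_of by simp
qed

text \<open>In the old complex \<open>b\<close> and \<open>d\<close> span no edge, so one of their
  coordinates is zero. After the map the smaller of the two is exactly the amount exchanged, and the
  reverse exchange restores the point.\<close>

lemma flip_map_inverse:
  assumes x: "x \<in> underlying_space (complex_of F)"
  shows "flip_map b d a c (flip_map a c b d x) = x"
proof -
  obtain T where T: "T \<in> F" "\<And>v. v \<notin> T \<Longrightarrow> x v = 0"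
    and nn: "\<And>v. 0 \<le> x v"
    using x unfolding underlying_space_complex_of by blast
  have "b \<notin> T \<or> d \<notin> T" using T(1) not_bd dist by (auto simp: F_def)
  then have "min (x b) (x d) = 0" using T(2)[of b] T(2)[of d] nn[of b] nn[of d] by (auto simp: min_def)
  moreover have "flip_map a c b d x b = x b + min (x a) (x c)"
    "flip_map a c b d x d = x d + min (x a) (x c)"
    using dist by (auto simp: flip_map_def)
  ultimately have "min (flip_map a c b d x b) (flip_map a c b d x d) = min (x a) (x c)"
    by (simp add: min_add_distrib_left)
  then show ?thesis
    by (auto simp: fun_eq_iff flip_map_def[of b d a c] flip_map_def[of a c b d] algebra_simps)
qed

text \<open>Renaming the corners cyclically yields the reverse flip, so the facts about the inverse
  map are instances of those already proved.\<close>

lemma edge_flip_swap: "edge_flip b c d a G F' F"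
proof
  show "F = {{c, b, a}, {c, a, d}} \<union> G" unfolding F_def by (simp add: insert_commute)
  show "F' = {{b, c, d}, {b, d, a}} \<union> G" unfolding F'_def by (auto simp add: insert_commute)
qed (use dist finite_facets not_ac not_bd in auto)

end

lemma edge_flip_homeomorphic:
  assumes "edge_flip a b c d G F F'"
  shows "top_of_set (underlying_space (complex_of F)) homeomorphic_space
         top_of_set (underlying_space (complex_of F'))"
proof -
  interpret f: edge_flip a b c d G F F' by fact
  interpret g: edge_flip b c d a G F' F by (rule f.edge_flip_swap)
  \<comment> \<open>The interpretation \<open>g\<close> names the ends of a diagonal in the opposite
    order; the flip map is symmetric in the ends of each diagonal.\<close>
  have comm: "flip_map b d c a = flip_map b d a c"
    by (auto simp: flip_map_def fun_eq_iff algebra_simps)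
  have comm': "flip_map c a b d = flip_map a c b d"
    by (auto simp: flip_map_def fun_eq_iff algebra_simps min.commute)
  have "homeomorphic_maps (top_of_set (underlying_space (complex_of F)))
         (top_of_set (underlying_space (complex_of F'))) (flip_map a c b d) (flip_map b d a c)"
    using f.flip_map_in g.flip_map_in f.flip_map_inverse g.flip_map_inverse
    unfolding homeomorphic_maps_def comm continuous_map_iff_continuous
    by (auto simp: continuous_on_flip_map comm')
  then show ?thesis unfolding homeomorphic_space_def by blast
qed


section \<open>A grid triangulation of the Klein bottle\<close>

lemma topspace_quotient_topology:
  assumes "equiv (topspace X) R"
  shows "topspace (quotient_topology X R) = topspace X // R"
proof -
  have "openin (quotient_topology X R) (topspace X // R)"
    using Union_quotient[OF assms] by (simp add: openin_quotient_topology[OF assms])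
  then show ?thesis
    unfolding topspace_def openin_quotient_topology[OF assms] by blast
qed

lemma quotient_map_proj:
  assumes R: "equiv (topspace X) R"
  shows "quotient_map X (quotient_topology X R) (\<lambda>x. R `` {x})"
  unfolding quotient_map_def topspace_quotient_topology[OF R]
proof (intro conjI allI impI)
  show "(\<lambda>x. R `` {x}) ` topspace X = topspace X // R"
    by (auto simp: quotient_def)
next
  fix U assume U: "U \<subseteq> topspace X // R"
  have "{x \<in> topspace X. R `` {x} \<in> U} = \<Union>U"
  proof (intro set_eqI iffI)
    fix x assume "x \<in> {x \<in> topspace X. R `` {x} \<in> U}"
    then show "x \<in> \<Union>U" using equiv_class_self[OF R, of x] by blast
  next
    fix x assume "x \<in> \<Union>U"
    then obtain u where u: "u \<in> U" "x \<in> u" by auto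
    then obtain y where y: "y \<in> topspace X" "u = R `` {y}" using U by (auto elim!: quotientE)
    then have "(y, x) \<in> R" using u by auto
    then have "x \<in> topspace X" "R `` {x} = u"
      using R y by (auto simp: equiv_class_eq_iff)
    then show "x \<in> {x \<in> topspace X. R `` {x} \<in> U}" using u by auto
  qed
  then show "openin X {x \<in> topspace X. R `` {x} \<in> U} = openin (quotient_topology X R) U"
    using U by (simp add: openin_quotient_topology[OF R])
qed

text \<open>The map induced on classes is injective because the fibres are the classes, and it is a
  quotient map because its composite with the projection is one; an injective quotient map is a
  homeomorphism.\<close>

lemma homeomorphic_space_quotient_topology:
  assumes R: "equiv (topspace X) R" and g: "quotient_map X Y g"
    and fibres: "\<And>x y. \<lbrakk>x \<in> topspace X; y \<in> topspace X\<rbrakk> \<Longrightarrow> g x = g y \<longleftrightarrow> (x, y) \<in> R"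
  shows "Y homeomorphic_space quotient_topology X R"
proof -
  let ?Q = "quotient_topology X R" and ?f = "\<lambda>x. R `` {x}"
  have f: "quotient_map X ?Q ?f" by (rule quotient_map_proj[OF R])
  have eq: "?f x = ?f y \<longleftrightarrow> (x, y) \<in> R" if "x \<in> topspace X" "y \<in> topspace X" for x y
    using eq_equiv_class_iff[OF R that] .
  obtain h where h: "continuous_map ?Q Y h" "\<And>x. x \<in> topspace X \<Longrightarrow> h (?f x) = g x"
    using quotient_map_lift_exists[OF f quotient_imp_continuous_map[OF g]] eq fibres by metis
  have "quotient_map X Y (h \<circ> ?f)" by (rule quotient_map_eq[OF g]) (simp add: h(2))
  then have "quotient_map ?Q Y h"
    by (rule quotient_map_from_composition[OF quotient_imp_continuous_map[OF f] h(1)])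
  moreover have "inj_on h (topspace ?Q)"
  proof (rule inj_onI)
    fix a b assume "a \<in> topspace ?Q" "b \<in> topspace ?Q" "h a = h b"
    moreover obtain x y where "x \<in> topspace X" "a = ?f x" "y \<in> topspace X" "b = ?f y"
      using calculation unfolding topspace_quotient_topology[OF R] by (auto elim!: quotientE)
    ultimately show "a = b" using h(2) fibres eq by metis
  qed
  ultimately have "homeomorphic_map ?Q Y h" by (simp add: homeomorphic_map_def)
  then show ?thesis
    using homeomorphic_map_imp_homeomorphic_space homeomorphic_space_sym by blast
qed

text \<open>The vertex at the point \<open>(i / 3, j / 3)\<close> of the unit square; the top row is the bottom row reversed.\<close>

definition grid_label :: "nat \<Rightarrow> nat \<Rightarrow> nat" where
  "grid_label i j = (if j = 3 then (3 - i) mod 3 else i mod 3 + 3 * j)"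

definition grid_facets :: "nat set set" where
  "grid_facets = (\<Union>i<3. \<Union>j<3.
     {{grid_label i j, grid_label (i + 1) j, grid_label (i + 1) (j + 1)},
      {grid_label i j, grid_label i (j + 1), grid_label (i + 1) (j + 1)}})"

text \<open>The piecewise linear hat function at the origin for the triangulation of the plane into unit squares cut along
  the direction \<open>(1, 1)\<close>.\<close>

definition hat :: "real \<Rightarrow> real \<Rightarrow> real" where
  "hat s t = max 0 (1 - max (max \<bar>s\<bar> \<bar>t\<bar>) \<bar>s - t\<bar>)"

text \<open>Grid points identified by the gluing carry the same label, so their hat functions add up
  to one coordinate, and the map is defined on the whole square without a choice of
  representatives.\<close>

definition grid_map :: "real \<times> real \<Rightarrow> nat \<Rightarrow> real" where
  "grid_map p v = (\<Sum>i\<le>3. \<Sum>j\<le>3. of_bool (grid_label i j = v) * hat (3 * fst p - real i) (3 * snd p - real j))"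

section \<open>The grid map on a single cell\<close>

lemma hat_far: "\<bar>s\<bar> \<ge> 1 \<or> \<bar>t\<bar> \<ge> 1 \<Longrightarrow> hat s t = 0"
  unfolding hat_def by linarith

lemma sum_pair_le3:
  fixes f :: "nat \<Rightarrow> real"
  assumes "i < 3" "\<And>k. k \<noteq> i \<Longrightarrow> k \<noteq> Suc i \<Longrightarrow> f k = 0"
  shows "(\<Sum>k\<le>3. f k) = f i + f (Suc i)"
proof -
  have "(\<Sum>k\<le>3. f k) = (\<Sum>k\<in>{i, Suc i}. f k)"
    using assms by (intro sum.mono_neutral_right) auto
  then show ?thesis by simp
qed

text \<open>The formula covers both triangles of the cell: of the coefficients
  \<open>max (s - t) 0\<close> and \<open>max (t - s) 0\<close> one vanishes on either side of the
  cut. It holds on the closed cell, so a point on a common side can be computed from either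
  cell.\<close>

lemma grid_map_cell:
  assumes ij: "i < 3" "j < 3" and st: "0 \<le> s" "s \<le> 1" "0 \<le> t" "t \<le> 1"
  shows "grid_map ((real i + s) / 3, (real j + t) / 3) v =
     (1 - max s t) * of_bool (grid_label i j = v) + max (s - t) 0 * of_bool (grid_label (i + 1) j = v)
     + max (t - s) 0 * of_bool (grid_label i (j + 1) = v) + min s t * of_bool (grid_label (i + 1) (j + 1) = v)"
proof -
  let ?h = "\<lambda>k l. hat (real i + s - real k) (real j + t - real l)"
  have far: "\<bar>real n + u - real k\<bar> \<ge> 1" if "k \<noteq> n" "k \<noteq> Suc n" "0 \<le> u" "u \<le> 1" for n k u
    using that by (cases "k < n") auto
  have 1: "(\<Sum>l\<le>3. of_bool (grid_label k l = v) * ?h k l)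
     = of_bool (grid_label k j = v) * ?h k j + of_bool (grid_label k (Suc j) = v) * ?h k (Suc j)" for k
    using ij st by (intro sum_pair_le3) (auto intro!: hat_far far)
  have "grid_map ((real i + s) / 3, (real j + t) / 3) v = (\<Sum>k\<le>3. \<Sum>l\<le>3. of_bool (grid_label k l = v) * ?h k l)"
    by (simp only: grid_map_def fst_conv snd_conv times_divide_eq_right nonzero_mult_div_cancel_left zero_neq_numeral not_False_eq_True)
  also have "\<dots> = (of_bool (grid_label i j = v) * ?h i j + of_bool (grid_label i (Suc j) = v) * ?h i (Suc j))
      + (of_bool (grid_label (Suc i) j = v) * ?h (Suc i) j + of_bool (grid_label (Suc i) (Suc j) = v) * ?h (Suc i) (Suc j))"
    unfolding 1 using ij st by (intro sum_pair_le3) (auto simp: hat_far far)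
  also have "?h i j = 1 - max s t" using st by (auto simp: hat_def)
  also have "?h i (Suc j) = max (t - s) 0" using st by (auto simp: hat_def)
  also have "?h (Suc i) j = max (s - t) 0" using st by (auto simp: hat_def)
  also have "?h (Suc i) (Suc j) = min s t" using st by (auto simp: hat_def)
  finally show ?thesis by simp
qed

lemma less3_cases: "(i::nat) < 3 \<Longrightarrow> i = 0 \<or> i = 1 \<or> i = 2" by linarith

lemma grid_label_less: "i \<le> 3 \<Longrightarrow> j \<le> 3 \<Longrightarrow> grid_label i j < 9"
  by (auto simp: grid_label_def intro!: mod_less_divisor[THEN less_le_trans])

text \<open>Only the right end of the interval gets offset 1; all other points have a half-open
  offset, which makes their representation unique.\<close>

lemma unit_interval_cells:
  fixes x :: real assumes "0 \<le> x" "x \<le> 1"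
  obtains i s where "i < 3" "0 \<le> s" "s \<le> 1" "x = (real i + s) / 3" "x < 1 \<longrightarrow> s < 1"
proof -
  consider "x < 1/3" | "1/3 \<le> x" "x < 2/3" | "2/3 \<le> x" by linarith
  then show thesis
  proof cases
    case 1 with that[of 0 "3 * x"] assms show thesis by auto
  next
    case 2 with that[of 1 "3 * x - 1"] assms show thesis by auto
  next
    case 3 with that[of 2 "3 * x - 2"] assms show thesis by auto
  qed
qed

lemma half_open_unit_interval_cells:
  fixes x :: real assumes "0 \<le> x" "x < 1"
  obtains i s where "i < 3" "0 \<le> s" "s < 1" "x = (real i + s) / 3"
  using unit_interval_cells[of x] assms by (metis less_imp_le)

lemma grid_map_gluing:
  assumes "(p, q) \<in> klein_gluing"
  shows "grid_map p = grid_map q"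
proof -
  from assms consider y where "p = (0, y)" "q = (1, y)" "0 \<le> y" "y \<le> 1"
    | x where "p = (x, 0)" "q = (1 - x, 1)" "0 \<le> x" "x \<le> 1"
    by (auto simp: klein_gluing_def)
  then show ?thesis
  proof cases
    case 1
    obtain j t where j: "j < 3" "0 \<le> t" "t \<le> 1" "y = (real j + t) / 3"
      using unit_interval_cells[OF 1(3,4)] by metis
    have p: "p = ((real 0 + 0) / 3, (real j + t) / 3)" "q = ((real 2 + 1) / 3, (real j + t) / 3)"
      using 1 j by auto
    have l: "grid_label 3 j = grid_label 0 j" "grid_label 3 (j + 1) = grid_label 0 (j + 1)"
      using less3_cases[OF j(1)] by (auto simp: grid_label_def)
    have "grid_map p v = grid_map q v" for v
      unfolding p using j l grid_map_cell[of 0 j 0 t v] grid_map_cell[of 2 j 1 t v] by simp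
    then show ?thesis by (rule ext)
  next
    case 2
    obtain i s where i: "i < 3" "0 \<le> s" "s \<le> 1" "x = (real i + s) / 3"
      using unit_interval_cells[OF 2(3,4)] by metis
    \<comment> \<open>Reflecting the interval takes cell \<open>i\<close> to cell
      \<open>2 - i\<close> and offset \<open>s\<close> to \<open>1 - s\<close>.\<close>
    have p: "p = ((real i + s) / 3, (real 0 + 0) / 3)" "q = ((real (2 - i) + (1 - s)) / 3, (real 2 + 1) / 3)"
      using 2 i by (auto simp: of_nat_diff field_simps)
    have l: "grid_label (2 - i) 3 = grid_label (i + 1) 0" "grid_label (2 - i + 1) 3 = grid_label i 0"
      using less3_cases[OF i(1)] by (auto simp: grid_label_def)
    have "grid_map p v = grid_map q v" for v
      unfolding p using i l grid_map_cell[of i 0 s 0 v] grid_map_cell[of "2 - i" 2 "1 - s" 1 v] by simp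
    then show ?thesis by (rule ext)
  qed
qed

section \<open>Fibres of the grid map\<close>

lemma grid_map_klein_rel:
  assumes "(p, q) \<in> klein_rel"
  shows "grid_map p = grid_map q"
proof -
  have "(p, q) \<in> (klein_gluing \<union> klein_gluing\<inverse>)\<^sup>*" using assms by (simp add: klein_rel_def)
  then show ?thesis
    by induction (auto dest: grid_map_gluing)
qed

lemma klein_gluing_subset: "klein_gluing \<subseteq> unit_square \<times> unit_square"
  by (auto simp: klein_gluing_def)

lemma klein_gluing_imp_rel: "(p, q) \<in> klein_gluing \<Longrightarrow> (p, q) \<in> klein_rel"
  "(p, q) \<in> klein_gluing \<Longrightarrow> (q, p) \<in> klein_rel"
  using klein_gluing_subset unfolding klein_rel_def by blast+

lemma klein_rel_trans: "(p, q) \<in> klein_rel \<Longrightarrow> (q, r) \<in> klein_rel \<Longrightarrow> (p, r) \<in> klein_rel"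
  using equiv_klein_rel by (meson equivE transD)

lemma klein_rel_canonical:
  assumes "p \<in> unit_square"
  obtains q where "(p, q) \<in> klein_rel" "q \<in> {0..<1} \<times> {0..<1}"
proof -
  have refl: "(r, r) \<in> klein_rel" if "r \<in> unit_square" for r
    using equiv_klein_rel that by (meson equivE refl_onD)
  have side: "\<exists>q. (r, q) \<in> klein_rel \<and> 0 \<le> fst q \<and> fst q < 1 \<and> snd q = snd r" if r: "r \<in> unit_square" for r
  proof (cases "fst r = 1")
    case True
    then have "((0, snd r), r) \<in> klein_gluing" using r by (cases r) (auto simp: klein_gluing_def)
    then have "(r, (0, snd r)) \<in> klein_rel" by (rule klein_gluing_imp_rel)
    then show ?thesis by force
  next
    case False
    then show ?thesis using refl[OF r] r by (intro exI[of _ r]) auto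
  qed
  obtain q where q: "(p, q) \<in> klein_rel" "0 \<le> fst q" "fst q < 1" "snd q = snd p"
    using side[OF assms] by blast
  show thesis
  proof (cases "snd q = 1")
    case True
    \<comment> \<open>Passing from the top to the bottom side reflects the first coordinate, which
      may become 1; the passage from the right to the left side is therefore repeated.\<close>
    then have "((1 - fst q, 0), q) \<in> klein_gluing" using q by (cases q) (auto simp: klein_gluing_def)
    then have *: "(q, (1 - fst q, 0)) \<in> klein_rel" by (rule klein_gluing_imp_rel)
    obtain r where "((1 - fst q, 0), r) \<in> klein_rel" "0 \<le> fst r" "fst r < 1" "snd r = 0"
      using side[of "(1 - fst q, 0)"] q by auto
    then show thesis
      using that[of r] klein_rel_trans[OF klein_rel_trans[OF q(1) *]] by (cases r) auto
  next
    case False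
    then show thesis using that[OF q(1)] q assms by (cases q) auto
  qed
qed

text \<open>Summing over a row of labels forgets the horizontal position. What remains is the
  height, as a point on the cycle of the three rows, on which the top and the bottom side
  coincide.\<close>

lemma grid_map_row:
  assumes "i < 3" "j < 3" "r < 3" "0 \<le> s" "s \<le> 1" "0 \<le> t" "t \<le> 1"
  shows "(\<Sum>u<3. grid_map ((real i + s) / 3, (real j + t) / 3) (u + 3 * r))
    = (1 - t) * of_bool (r = j) + t * of_bool (r = (j + 1) mod 3)"
proof -
  have row: "(\<Sum>u<3. c * of_bool (grid_label k l = u + 3 * r)) = c * of_bool (r = l mod 3)"
    if "l \<le> 3" for k l and c :: real
  proof -
    have div: "grid_label k l div 3 = l mod 3" using that by (cases "l = 3") (auto simp: grid_label_def)
    have "grid_label k l = u + 3 * r \<longleftrightarrow> r = l mod 3 \<and> u = grid_label k l mod 3" if "u < 3" for u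
      using that div div_mult_mod_eq[of "grid_label k l" 3] by auto
    then have "(\<Sum>u<3. c * of_bool (grid_label k l = u + 3 * r))
      = (\<Sum>u<3. if u = grid_label k l mod 3 then c * of_bool (r = l mod 3) else 0)"
      by (intro sum.cong) auto
    then show ?thesis by (simp add: sum.delta)
  qed
  have le: "j \<le> 3" "j + 1 \<le> 3" using assms(2) by auto
  have "(\<Sum>u<3. grid_map ((real i + s) / 3, (real j + t) / 3) (u + 3 * r))
    = (1 - max s t) * of_bool (r = j mod 3) + max (s - t) 0 * of_bool (r = j mod 3)
      + max (t - s) 0 * of_bool (r = (j + 1) mod 3) + min s t * of_bool (r = (j + 1) mod 3)"
    unfolding grid_map_cell[OF assms(1,2,4-)] by (simp only: sum.distrib row[OF le(1)] row[OF le(2)])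
  then have "(\<Sum>u<3. grid_map ((real i + s) / 3, (real j + t) / 3) (u + 3 * r))
    = (1 - max s t + max (s - t) 0) * of_bool (r = j mod 3) + (max (t - s) 0 + min s t) * of_bool (r = (j + 1) mod 3)"
    by (simp only: distrib_right add.assoc)
  moreover have "1 - max s t + max (s - t) 0 = 1 - t" "max (t - s) 0 + min s t = t" by linarith+
  ultimately show ?thesis using assms(2) by simp
qed

text \<open>Columns do not close up, because the top row is reversed. Hence only the two rows
  bounding the strip of the point are summed, and that strip has to be known beforehand from
  \<open>grid_map_row\<close>.\<close>

lemma grid_map_column:
  assumes "i < 3" "j < 3" "k < 3" "0 \<le> s" "s \<le> 1" "0 \<le> t" "t \<le> 1"
  shows "grid_map ((real i + s) / 3, (real j + t) / 3) (grid_label k j)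
      + grid_map ((real i + s) / 3, (real j + t) / 3) (grid_label k (j + 1))
    = (1 - s) * of_bool (k = i) + s * of_bool (k = (i + 1) mod 3)"
proof -
  have lab: "grid_label m l = grid_label k l' \<longleftrightarrow> l = l' \<and> m mod 3 = k"
    if "m \<le> 3" "l = j \<or> l = j + 1" "l' = j \<or> l' = j + 1" for m l l'
  proof -
    have "m = 0 \<or> m = 1 \<or> m = 2 \<or> m = 3" using that by linarith
    then show ?thesis
      using that(2,3) less3_cases[OF assms(2)] less3_cases[OF assms(3)]
      by (elim disjE) (simp_all add: grid_label_def)
  qed
  have coeff: "1 - max s t + max (t - s) 0 = 1 - s" "max (s - t) 0 + min s t = s" by linarith+
  have index: "i mod 3 = k \<longleftrightarrow> k = i" "(i + 1) mod 3 = k \<longleftrightarrow> k = (i + 1) mod 3"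
    using assms(1) by auto
  have "grid_map ((real i + s) / 3, (real j + t) / 3) (grid_label k j)
      + grid_map ((real i + s) / 3, (real j + t) / 3) (grid_label k (j + 1))
    = (1 - max s t + max (t - s) 0) * of_bool (i mod 3 = k) + (max (s - t) 0 + min s t) * of_bool ((i + 1) mod 3 = k)"
    unfolding grid_map_cell[OF assms(1,2,4-)] using assms(1) by (simp add: lab ring_distribs)
  then show ?thesis unfolding coeff index .
qed

text \<open>The three weights are the barycentric coordinates of a point on the boundary of a
  triangle; with half-open offsets each point has a single description.\<close>

lemma cyclic_weights_inj:
  fixes t t' :: real and j j' :: nat
  assumes "j < 3" "j' < 3" "0 \<le> t" "t < 1" "0 \<le> t'" "t' < 1"
    and "\<And>r. r < 3 \<Longrightarrow> (1 - t) * of_bool (r = j) + t * of_bool (r = (j + 1) mod 3)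
      = (1 - t') * of_bool (r = j') + t' * of_bool (r = (j' + 1) mod 3)"
  shows "j' = j \<and> t' = t"
  using less3_cases[OF assms(1)] less3_cases[OF assms(2)] assms(3-6) assms(7)[of 0] assms(7)[of 1] assms(7)[of 2]
  by (elim disjE) simp_all

lemma grid_map_inj_canonical:
  assumes "p \<in> {0..<1} \<times> {0..<1}" "q \<in> {0..<1} \<times> {0..<1}" and eq: "grid_map p = grid_map q"
  shows "p = q"
proof -
  obtain i s where i: "i < 3" "0 \<le> s" "s < 1" "fst p = (real i + s) / 3"
    using half_open_unit_interval_cells[of "fst p"] assms by (auto simp: mem_Times_iff)
  obtain j t where j: "j < 3" "0 \<le> t" "t < 1" "snd p = (real j + t) / 3"
    using half_open_unit_interval_cells[of "snd p"] assms by (auto simp: mem_Times_iff)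
  obtain i' s' where i': "i' < 3" "0 \<le> s'" "s' < 1" "fst q = (real i' + s') / 3"
    using half_open_unit_interval_cells[of "fst q"] assms by (auto simp: mem_Times_iff)
  obtain j' t' where j': "j' < 3" "0 \<le> t'" "t' < 1" "snd q = (real j' + t') / 3"
    using half_open_unit_interval_cells[of "snd q"] assms by (auto simp: mem_Times_iff)
  have p: "p = ((real i + s) / 3, (real j + t) / 3)" and q: "q = ((real i' + s') / 3, (real j' + t') / 3)"
    using i j i' j' by (auto simp: prod_eq_iff)
  have jj: "j' = j \<and> t' = t"
    using grid_map_row[of i j _ s t] grid_map_row[of i' j' _ s' t'] eq p q i j i' j'
    by (intro cyclic_weights_inj) simp_all
  have "i' = i \<and> s' = s"
    using grid_map_column[of i j _ s t] grid_map_column[of i' j _ s' t] eq p q i j i' j' jj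
    by (intro cyclic_weights_inj) simp_all
  then show ?thesis using p q jj by simp
qed

section \<open>Image of the grid map\<close>

lemma finite_grid_facets: "finite grid_facets"
  by (simp add: grid_facets_def)

lemma Union_grid_facets: "\<Union>grid_facets = {..<9}"
proof
  show "\<Union>grid_facets \<subseteq> {..<9}"
    by (auto simp: grid_facets_def intro!: grid_label_less)
  have "v \<in> \<Union>grid_facets" if "v < 9" for v
  proof -
    have "v = grid_label (v mod 3) (v div 3)" "v div 3 < 3" using that by (auto simp: grid_label_def)
    moreover have "v mod 3 < 3" by simp
    ultimately show ?thesis unfolding grid_facets_def by blast
  qed
  then show "{..<9} \<subseteq> \<Union>grid_facets" by blast
qed

lemma grid_map_in_underlying_space:
  assumes "p \<in> unit_square"
  shows "grid_map p \<in> underlying_space (complex_of grid_facets)"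
proof -
  have bounds: "0 \<le> fst p" "fst p \<le> 1" "0 \<le> snd p" "snd p \<le> 1"
    using assms by (simp_all add: mem_Times_iff)
  obtain i s where i: "i < 3" "0 \<le> s" "s \<le> 1" "fst p = (real i + s) / 3"
    using unit_interval_cells[OF bounds(1,2)] by metis
  obtain j t where j: "j < 3" "0 \<le> t" "t \<le> 1" "snd p = (real j + t) / 3"
    using unit_interval_cells[OF bounds(3,4)] by metis
  have p: "p = ((real i + s) / 3, (real j + t) / 3)" using i j by (auto simp: prod_eq_iff)
  note cell = grid_map_cell[OF i(1) j(1) i(2,3) j(2,3), folded p]
  have nonneg: "0 \<le> grid_map p v" for v
    unfolding cell using i j by (intro add_nonneg_nonneg mult_nonneg_nonneg) auto
  have one: "(\<Sum>v<9. c * of_bool (grid_label k l = v)) = c" if "k \<le> 3" "l \<le> 3" for k l and c :: real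
  proof -
    have "(\<Sum>v<9. c * of_bool (grid_label k l = v)) = (\<Sum>v<9. if grid_label k l = v then c else 0)"
      by (intro sum.cong) auto
    then show ?thesis using grid_label_less[OF that] by (simp add: sum.delta')
  qed
  have le: "i \<le> 3" "i + 1 \<le> 3" "j \<le> 3" "j + 1 \<le> 3" using i j by auto
  have "(\<Sum>v<9. grid_map p v) = (1 - max s t) + max (s - t) 0 + max (t - s) 0 + min s t"
    unfolding cell by (simp only: sum.distrib one[OF le(1,3)] one[OF le(1,4)] one[OF le(2,3)] one[OF le(2,4)])
  also have "\<dots> = 1" by linarith
  finally have "(\<Sum>v\<in>\<Union>grid_facets. grid_map p v) = 1" by (simp add: Union_grid_facets)
  moreover have "\<exists>T\<in>grid_facets. \<forall>v. v \<notin> T \<longrightarrow> grid_map p v = 0"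
  proof (cases "t \<le> s")
    case True
    then have "\<forall>v. v \<notin> {grid_label i j, grid_label (i + 1) j, grid_label (i + 1) (j + 1)} \<longrightarrow> grid_map p v = 0"
      unfolding cell by auto
    then show ?thesis using i j unfolding grid_facets_def by blast
  next
    case False
    then have "\<forall>v. v \<notin> {grid_label i j, grid_label i (j + 1), grid_label (i + 1) (j + 1)} \<longrightarrow> grid_map p v = 0"
      unfolding cell by auto
    then show ?thesis using i j unfolding grid_facets_def by blast
  qed
  ultimately show ?thesis using nonneg unfolding underlying_space_complex_of by blast
qed

lemma grid_cell_labels_distinct:
  assumes "i < 3" "j < 3"
  shows "distinct [grid_label i j, grid_label (i + 1) j, grid_label i (j + 1), grid_label (i + 1) (j + 1)]"
  using less3_cases[OF assms(1)] less3_cases[OF assms(2)] by (elim disjE) (simp_all add: grid_label_def)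

lemma grid_map_surj:
  assumes "x \<in> underlying_space (complex_of grid_facets)"
  obtains p where "p \<in> unit_square" "grid_map p = x"
proof -
  obtain T where T: "T \<in> grid_facets" "\<And>v. v \<notin> T \<Longrightarrow> x v = 0"
    and nonneg: "\<And>v. 0 \<le> x v" and sum1: "(\<Sum>v\<in>\<Union>grid_facets. x v) = 1"
    using assms unfolding underlying_space_complex_of by blast
  obtain i j where ij: "i < 3" "j < 3" and "T = {grid_label i j, grid_label (i + 1) j, grid_label (i + 1) (j + 1)}
      \<or> T = {grid_label i j, grid_label i (j + 1), grid_label (i + 1) (j + 1)}"
    using T(1) unfolding grid_facets_def by blast
  then consider (lower) "T = {grid_label i j, grid_label (i + 1) j, grid_label (i + 1) (j + 1)}"
    | (upper) "T = {grid_label i j, grid_label i (j + 1), grid_label (i + 1) (j + 1)}" by blast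
  note case_T = this
  define A B C D where "A = grid_label i j" and "B = grid_label (i + 1) j"
    and "C = grid_label i (j + 1)" and "D = grid_label (i + 1) (j + 1)"
  have dist: "distinct [A, B, C, D]"
    using grid_cell_labels_distinct[OF ij] by (simp add: A_def B_def C_def D_def)
  have T1: "(\<Sum>v\<in>T. x v) = 1"
    using sum1 T finite_grid_facets Union_grid_facets
    by (subst sum.mono_neutral_left[of "\<Union>grid_facets"]) auto
  have in_square: "((real i + s) / 3, (real j + t) / 3) \<in> unit_square"
    if "0 \<le> s" "s \<le> 1" "0 \<le> t" "t \<le> 1" for s t
    using ij that by (auto simp: field_simps)
  note cell = grid_map_cell[OF ij, folded A_def B_def C_def D_def]
  from case_T show thesis
  proof cases
    case lower
    then have T': "T = {A, B, D}" by (simp add: A_def B_def D_def)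
    have 1: "x A + x B + x D = 1" using T1 dist unfolding T' by (simp add: add.assoc)
    \<comment> \<open>The formula for the cell, solved for the offsets: the weights of the two right
      corners add up to the horizontal offset, those of the two upper corners to the vertical
      one.\<close>
    let ?s = "x B + x D" and ?t = "x D"
    have st: "0 \<le> ?s" "?s \<le> 1" "0 \<le> ?t" "?t \<le> 1" "?t \<le> ?s"
      using nonneg[of A] nonneg[of B] nonneg[of D] 1 by linarith+
    have coeff: "1 - max ?s ?t = x A" "max (?s - ?t) 0 = x B" "max (?t - ?s) 0 = 0" "min ?s ?t = x D"
      using st 1 nonneg[of B] by linarith+
    have "grid_map ((real i + ?s) / 3, (real j + ?t) / 3) v = x v" for v
    proof -
      consider "v = A" | "v = B" | "v = D" | "v \<notin> T" unfolding T' by blast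
      then show ?thesis
        unfolding cell[OF st(1-4)] coeff using dist T(2)[of v] T' by cases auto
    qed
    then show thesis using that[OF in_square[OF st(1-4)]] by blast
  next
    case upper
    then have T': "T = {A, C, D}" by (simp add: A_def C_def D_def)
    have 1: "x A + x C + x D = 1" using T1 dist unfolding T' by (simp add: add.assoc)
    let ?s = "x D" and ?t = "x C + x D"
    have st: "0 \<le> ?s" "?s \<le> 1" "0 \<le> ?t" "?t \<le> 1" "?s \<le> ?t"
      using nonneg[of A] nonneg[of C] nonneg[of D] 1 by linarith+
    have coeff: "1 - max ?s ?t = x A" "max (?s - ?t) 0 = 0" "max (?t - ?s) 0 = x C" "min ?s ?t = x D"
      using st 1 nonneg[of C] by linarith+
    have "grid_map ((real i + ?s) / 3, (real j + ?t) / 3) v = x v" for v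
    proof -
      consider "v = A" | "v = C" | "v = D" | "v \<notin> T" unfolding T' by blast
      then show ?thesis
        unfolding cell[OF st(1-4)] coeff using dist T(2)[of v] T' by cases auto
    qed
    then show thesis using that[OF in_square[OF st(1-4)]] by blast
  qed
qed

lemma continuous_on_grid_map: "continuous_on S grid_map"
proof (rule continuous_on_coordinatewise_then_product)
  fix v
  show "continuous_on S (\<lambda>p. grid_map p v)"
    unfolding grid_map_def hat_def by (intro continuous_intros)
qed

lemma grid_map_eq_iff:
  assumes "p \<in> unit_square" "q \<in> unit_square"
  shows "grid_map p = grid_map q \<longleftrightarrow> (p, q) \<in> klein_rel"
proof
  assume eq: "grid_map p = grid_map q"
  obtain p' where p': "(p, p') \<in> klein_rel" "p' \<in> {0..<1} \<times> {0..<1}"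
    using klein_rel_canonical[OF assms(1)] by blast
  obtain q' where q': "(q, q') \<in> klein_rel" "q' \<in> {0..<1} \<times> {0..<1}"
    using klein_rel_canonical[OF assms(2)] by blast
  have "p' = q'"
    using eq p' q' grid_map_klein_rel by (intro grid_map_inj_canonical) metis+
  then show "(p, q) \<in> klein_rel"
    using p'(1) q'(1) equiv_klein_rel klein_rel_trans by (meson equivE symD)
qed (rule grid_map_klein_rel)

text \<open>A continuous surjection from a compact space to a Hausdorff space is a quotient map, and
  the fibres of this one are the gluing classes.\<close>

lemma grid_triangulation:
  "top_of_set (underlying_space (complex_of grid_facets)) homeomorphic_space klein_bottle"
  unfolding klein_bottle_def
proof (rule homeomorphic_space_quotient_topology)
  show "equiv (topspace (top_of_set unit_square)) klein_rel" using equiv_klein_rel by simp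
  have "compact unit_square" by (intro compact_Times compact_Icc)
  then have compact: "compact_space (top_of_set unit_square)" by (simp add: compact_space_subtopology)
  have image: "grid_map ` unit_square = underlying_space (complex_of grid_facets)"
    using grid_map_in_underlying_space grid_map_surj by blast
  show "quotient_map (top_of_set unit_square) (top_of_set (underlying_space (complex_of grid_facets))) grid_map"
  proof (rule T1_Spaces.continuous_imp_quotient_map[OF _ compact])
    show "continuous_map (top_of_set unit_square) (top_of_set (underlying_space (complex_of grid_facets))) grid_map"
      using image by (auto simp: continuous_on_grid_map)
    show "Hausdorff_space (top_of_set (underlying_space (complex_of grid_facets)))"
      by (intro Hausdorff_space_subtopology Hausdorff_space_euclidean)
  qed (simp add: image)
  show "grid_map p = grid_map q \<longleftrightarrow> (p, q) \<in> klein_rel"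
    if "p \<in> topspace (top_of_set unit_square)" "q \<in> topspace (top_of_set unit_square)" for p q
    using grid_map_eq_iff that by simp
qed


section \<open>Local injectivity\<close>

lemma simplexwise_linear_complex_of:
  "simplexwise_linear (complex_of F) \<psi> x = (\<Sum>v\<in>\<Union>F. x v *\<^sub>R \<psi> v)"
  by (simp add: simplexwise_linear_def vertices_complex_of)

text \<open>Every point has a positive coordinate at some vertex, and the open star of that vertex
  is a neighbourhood of it. The hypothesis uses vectors from \<open>v\<close> and fixes no total
  weight: it speaks of cones, whose relations are linear and homogeneous.\<close>

lemma polyhedral_realization_if_stars_injective:
  fixes \<psi> :: "'v \<Rightarrow> real^3"
  assumes fin: "finite F" "\<And>T. T \<in> F \<Longrightarrow> finite T"
    and star: "\<And>v S T x y u. \<lbrakk>S \<in> F; T \<in> F; v \<in> S; v \<in> T; \<And>w. 0 \<le> x w; \<And>w. 0 \<le> y w;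
       \<And>w. w \<notin> S \<Longrightarrow> x w = 0; \<And>w. w \<notin> T \<Longrightarrow> y w = 0;
       (\<Sum>w\<in>S. x w *\<^sub>R (\<psi> w - \<psi> v)) = (\<Sum>w\<in>T. y w *\<^sub>R (\<psi> w - \<psi> v)); u \<noteq> v\<rbrakk> \<Longrightarrow> x u = (y u :: real)"
  shows "polyhedral_realization (complex_of F) \<psi>"
  unfolding polyhedral_realization_def locally_injective_def topspace_euclidean_subtopology
proof
  let ?X = "underlying_space (complex_of F)" and ?f = "simplexwise_linear (complex_of F) \<psi>"
  have finU: "finite (\<Union>F)" using fin by auto
  fix x0 assume x0: "x0 \<in> ?X"
  then have "(\<Sum>v\<in>\<Union>F. x0 v) = 1" "\<And>v. 0 \<le> x0 v" unfolding underlying_space_complex_of by auto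
  then obtain v where v: "v \<in> \<Union>F" "0 < x0 v"
    by (metis less_eq_real_def sum.neutral zero_neq_one)
  define U where "U = ?X \<inter> {x. 0 < x v}"
  have "open {x :: 'v \<Rightarrow> real. 0 < x v}"
    by (intro open_Collect_less continuous_on_product_coordinates continuous_on_const)
  then have "openin (top_of_set ?X) U" unfolding U_def by (rule openin_open_Int)
  moreover have "x0 \<in> U" using x0 v by (simp add: U_def)
  moreover have "inj_on ?f U"
  proof (rule inj_onI)
    fix x y assume xy: "x \<in> U" "y \<in> U" "?f x = ?f y"
    obtain S where S: "S \<in> F" "\<And>w. w \<notin> S \<Longrightarrow> x w = 0" and x: "\<And>w. 0 \<le> x w" "(\<Sum>w\<in>\<Union>F. x w) = 1"
      using xy(1) underlying_space_complex_of[of x F] unfolding U_def by blast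
    obtain T where T: "T \<in> F" "\<And>w. w \<notin> T \<Longrightarrow> y w = 0" and y: "\<And>w. 0 \<le> y w" "(\<Sum>w\<in>\<Union>F. y w) = 1"
      using xy(2) underlying_space_complex_of[of y F] unfolding U_def by blast
    have vST: "v \<in> S" "v \<in> T" using xy S T unfolding U_def by force+
    have shift: "(\<Sum>w\<in>R. z w *\<^sub>R (\<psi> w - \<psi> v)) = ?f z - \<psi> v"
      if "R \<in> F" "\<And>w. w \<notin> R \<Longrightarrow> z w = 0" "(\<Sum>w\<in>\<Union>F. z w) = 1" for R z
    proof -
      have "(\<Sum>w\<in>R. z w *\<^sub>R (\<psi> w - \<psi> v)) = (\<Sum>w\<in>\<Union>F. z w *\<^sub>R (\<psi> w - \<psi> v))"
        using that finU by (intro sum.mono_neutral_left) auto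
      also have "\<dots> = ?f z - (\<Sum>w\<in>\<Union>F. z w) *\<^sub>R \<psi> v"
        by (simp add: simplexwise_linear_complex_of scaleR_diff_right sum_subtractf scaleR_sum_left)
      finally show ?thesis using that by simp
    qed
    have "(\<Sum>w\<in>S. x w *\<^sub>R (\<psi> w - \<psi> v)) = ?f x - \<psi> v"
      by (rule shift[OF S(1) _ x(2)]) (rule S(2))
    moreover have "(\<Sum>w\<in>T. y w *\<^sub>R (\<psi> w - \<psi> v)) = ?f y - \<psi> v"
      by (rule shift[OF T(1) _ y(2)]) (rule T(2))
    ultimately have rel: "(\<Sum>w\<in>S. x w *\<^sub>R (\<psi> w - \<psi> v)) = (\<Sum>w\<in>T. y w *\<^sub>R (\<psi> w - \<psi> v))"
      using xy(3) by simp
    have eq: "x u = y u" if "u \<noteq> v" for u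
      by (rule star[OF S(1) T(1) vST x(1) y(1) S(2) T(2) rel that])
    \<comment> \<open>The coordinate at \<open>v\<close> does not enter the relation; it is
      recovered from the total weight 1.\<close>
    have "(\<Sum>w\<in>\<Union>F - {v}. x w) = (\<Sum>w\<in>\<Union>F - {v}. y w)" using eq by (intro sum.cong) auto
    then have "x v = y v" using x(2) y(2) finU v(1) by (simp add: sum_diff1)
    then show "x = y" using eq by (metis ext)
  qed
  ultimately show "\<exists>U. openin (top_of_set ?X) U \<and> x0 \<in> U \<and> inj_on ?f U" by blast
qed

section \<open>The determinant test\<close>

type_synonym triangle = "nat \<times> nat \<times> nat"
type_synonym point = "int \<times> int \<times> int"

fun incident :: "nat \<Rightarrow> triangle \<Rightarrow> bool" where
  "incident v (a, b, c) \<longleftrightarrow> v = a \<or> v = b \<or> v = c"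

fun diff :: "point \<Rightarrow> point \<Rightarrow> point" where
  "diff (x, y, z) (x', y', z') = (x - x', y - y', z - z')"

fun dot :: "point \<Rightarrow> point \<Rightarrow> int" where
  "dot (x, y, z) (x', y', z') = x * x' + y * y' + z * z'"

fun cross :: "point \<Rightarrow> point \<Rightarrow> point" where
  "cross (x, y, z) (x', y', z') = (y * z' - z * y', z * x' - x * z', x * y' - y * x')"

fun link_edge :: "nat \<Rightarrow> triangle \<Rightarrow> (nat \<times> nat) list" where
  "link_edge v (a, b, c) = (if v = a then [(b, c)] else if v = b then [(a, c)] else if v = c then [(a, b)] else [])"

text \<open>For an edge \<open>ab\<close> of the link of \<open>v\<close>: the labels, the vectors from \<open>v\<close> to \<open>a\<close> and \<open>b\<close>, and a normal of the
  plane they span.\<close>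

definition cone :: "point list \<Rightarrow> nat \<Rightarrow> nat \<times> nat \<Rightarrow> nat \<times> point \<times> nat \<times> point \<times> point" where
  "cone P v e = (case e of (a, b) \<Rightarrow> let p = diff (P ! a) (P ! v); q = diff (P ! b) (P ! v) in (a, p, b, q, cross p q))"

text \<open>Strict: zero agrees with no sign, so degenerate positions never pass as separated by
  accident.\<close>

fun same_sign :: "int \<Rightarrow> int \<Rightarrow> bool" where
  "same_sign x y \<longleftrightarrow> (if 0 < x then 0 < y else x < 0 \<and> y < 0)"

text \<open>The linear relation between four vectors is unique up to scaling and its coefficients are \<open>3 \<times> 3\<close> determinants,
  here \<open>f\<close>, \<open>- e\<close>, \<open>- h\<close>, \<open>g\<close> for \<open>\<alpha> p + \<beta> q = \<gamma> r + \<delta> s\<close>. The two cones meet only in the apex as soon as two of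
  these have opposite signs.\<close>

fun separated :: "nat \<times> point \<times> nat \<times> point \<times> point \<Rightarrow> nat \<times> point \<times> nat \<times> point \<times> point \<Rightarrow> bool" where
  "separated (a, p, b, q, n) (c, r, d, s, m) \<longleftrightarrow>
     (if a = c \<or> b = c then dot n s \<noteq> 0
      else if a = d \<or> b = d then dot n r \<noteq> 0
      else let g = dot n r; h = dot n s in if same_sign g h then True
      else let e = dot m p; f = dot m q in
        same_sign e f \<or> same_sign g (- f) \<or> same_sign g e \<or> same_sign h f \<or> same_sign h (- e))"

text \<open>Each pair is tested in one order only. The nonzero normal excludes a degenerate
  triangle, which is injectivity on a single cone.\<close>

fun all_separated :: "(nat \<times> point \<times> nat \<times> point \<times> point) list \<Rightarrow> bool" where
  "all_separated [] \<longleftrightarrow> True"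
| "all_separated (e # es) \<longleftrightarrow> snd (snd (snd (snd e))) \<noteq> (0, 0, 0) \<and> list_all (separated e) es \<and> all_separated es"

definition realizes :: "point list \<Rightarrow> triangle list \<Rightarrow> bool" where
  "realizes P L \<longleftrightarrow> list_all (\<lambda>v. all_separated (map (cone P v) (concat (map (link_edge v) L)))) [0..<9]"

definition triangle_set :: "triangle \<Rightarrow> nat set" where
  "triangle_set t = {v. incident v t}"

lemma triangle_set_simp [simp]: "triangle_set (a, b, c) = {a, b, c}"
  by (auto simp: triangle_set_def)

definition facets :: "triangle list \<Rightarrow> nat set set" where
  "facets L = triangle_set ` set L"

fun nondegenerate :: "triangle \<Rightarrow> bool" where
  "nondegenerate (a, b, c) \<longleftrightarrow> a \<noteq> b \<and> a \<noteq> c \<and> b \<noteq> c"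

fun to_vec :: "point \<Rightarrow> real^3" where
  "to_vec (x, y, z) = vector [real_of_int x, real_of_int y, real_of_int z]"

definition placement :: "point list \<Rightarrow> nat \<Rightarrow> real^3" where
  "placement P v = to_vec (P ! v)"

section \<open>Soundness of the determinant test\<close>

lemma to_vec_diff: "to_vec (diff p q) = to_vec p - to_vec q"
  by (cases p; cases q) (simp add: vec_eq_iff forall_3)

lemma placement_diff: "placement P a - placement P v = to_vec (diff (P ! a) (P ! v))"
  by (simp add: placement_def to_vec_diff)

lemma to_vec_eq_iff:
  "\<alpha> *\<^sub>R to_vec (p1, p2, p3) + \<beta> *\<^sub>R to_vec (q1, q2, q3) = \<gamma> *\<^sub>R to_vec (r1, r2, r3) + \<delta> *\<^sub>R to_vec (s1, s2, s3)
   \<longleftrightarrow> \<alpha> * real_of_int p1 + \<beta> * real_of_int q1 = \<gamma> * real_of_int r1 + \<delta> * real_of_int s1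
     \<and> \<alpha> * real_of_int p2 + \<beta> * real_of_int q2 = \<gamma> * real_of_int r2 + \<delta> * real_of_int s2
     \<and> \<alpha> * real_of_int p3 + \<beta> * real_of_int q3 = \<gamma> * real_of_int r3 + \<delta> * real_of_int s3"
  by (simp add: vec_eq_iff forall_3)

text \<open>Cramer's rule: the inner product with the cross product of two of the vectors eliminates
  both of them. The four equations use \<open>cross p q\<close>, \<open>cross r s\<close>,
  \<open>cross q r\<close> and \<open>cross r p\<close>.\<close>

lemma cone_relation:
  assumes "\<alpha> *\<^sub>R to_vec p + \<beta> *\<^sub>R to_vec q = \<gamma> *\<^sub>R to_vec r + \<delta> *\<^sub>R to_vec s"
  shows "\<gamma> * of_int (dot (cross p q) r) + \<delta> * of_int (dot (cross p q) s) = 0"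
    and "\<alpha> * of_int (dot (cross r s) p) + \<beta> * of_int (dot (cross r s) q) = 0"
    and "\<alpha> * of_int (dot (cross p q) r) = \<delta> * of_int (dot (cross r s) q)"
    and "\<beta> * of_int (dot (cross p q) r) = - \<delta> * of_int (dot (cross r s) p)"
proof -
  obtain p1 p2 p3 q1 q2 q3 r1 r2 r3 s1 s2 s3
    where *: "p = (p1, p2, p3)" "q = (q1, q2, q3)" "r = (r1, r2, r3)" "s = (s1, s2, s3)"
    by (cases p; cases q; cases r; cases s)
  note eqs = assms[unfolded * to_vec_eq_iff]
  show "\<gamma> * of_int (dot (cross p q) r) + \<delta> * of_int (dot (cross p q) s) = 0"
    using eqs unfolding * dot.simps cross.simps of_int_add of_int_mult of_int_diff by algebra
  show "\<alpha> * of_int (dot (cross r s) p) + \<beta> * of_int (dot (cross r s) q) = 0"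
    using eqs unfolding * dot.simps cross.simps of_int_add of_int_mult of_int_diff by algebra
  show "\<alpha> * of_int (dot (cross p q) r) = \<delta> * of_int (dot (cross r s) q)"
    using eqs unfolding * dot.simps cross.simps of_int_add of_int_mult of_int_diff by algebra
  show "\<beta> * of_int (dot (cross p q) r) = - \<delta> * of_int (dot (cross r s) p)"
    using eqs unfolding * dot.simps cross.simps of_int_add of_int_mult of_int_diff by algebra
qed

lemma nonneg_combination_zero:
  fixes x y :: real
  assumes "0 \<le> x" "0 \<le> y" "x * of_int a + y * of_int b = 0" "same_sign a b"
  shows "x = 0" "y = 0"
proof -
  have "(0 < a \<and> 0 < b) \<or> (a < 0 \<and> b < 0)" using assms(4) by (auto split: if_splits)
  then have "x * of_int a = 0 \<and> y * of_int b = 0 \<and> a \<noteq> 0 \<and> b \<noteq> 0"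
  proof
    assume ab: "0 < a \<and> 0 < b"
    then have "0 \<le> x * of_int a" "0 \<le> y * of_int b" using assms by simp_all
    then show ?thesis using assms(3) ab by linarith
  next
    assume ab: "a < 0 \<and> b < 0"
    then have "x * of_int a \<le> 0" "y * of_int b \<le> 0" using assms by (simp_all add: mult_nonneg_nonpos)
    then show ?thesis using assms(3) ab by linarith
  qed
  then show "x = 0" "y = 0" by auto
qed

lemma dot_cross_swap: "dot (cross q p) r = - dot (cross p q) r"
  by (cases p; cases q; cases r) (simp add: algebra_simps)

text \<open>There is one alternative for each pair of the four unknowns. Eliminating the other two
  leaves a relation with nonzero coefficients of equal sign, so the pair vanishes; further relations
  then annihilate the rest.\<close>

lemma separated_cones:
  assumes rel: "\<alpha> *\<^sub>R to_vec p + \<beta> *\<^sub>R to_vec q = \<gamma> *\<^sub>R to_vec r + \<delta> *\<^sub>R to_vec s"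
    and nonneg: "0 \<le> \<alpha>" "0 \<le> \<beta>" "0 \<le> \<gamma>" "0 \<le> \<delta>"
    and sep: "same_sign (dot (cross p q) r) (dot (cross p q) s) \<or> same_sign (dot (cross r s) p) (dot (cross r s) q)
       \<or> same_sign (dot (cross p q) r) (- dot (cross r s) q) \<or> same_sign (dot (cross p q) r) (dot (cross r s) p)
       \<or> same_sign (dot (cross p q) s) (dot (cross r s) q) \<or> same_sign (dot (cross p q) s) (- dot (cross r s) p)"
  shows "\<alpha> = 0 \<and> \<beta> = 0 \<and> \<gamma> = 0 \<and> \<delta> = 0"
proof -
  note R = cone_relation[OF rel]
  note R' = cone_relation[OF rel[symmetric]]
  \<comment> \<open>Exchanging \<open>r\<close> and \<open>s\<close> gives the relations with
    \<gamma> in place of \<delta>.\<close>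
  note R'' = cone_relation[OF rel[unfolded add.commute[of "\<gamma> *\<^sub>R to_vec r"]], unfolded dot_cross_swap[of s r]]
  have nz: "a \<noteq> 0" "b \<noteq> 0" if "same_sign a b" for a b using that by (auto split: if_splits)
  from sep show ?thesis
  proof (elim disjE)
    assume ss: "same_sign (dot (cross p q) r) (dot (cross p q) s)"
    from nonneg_combination_zero[OF nonneg(3,4) R(1) this] have "\<gamma> = 0" "\<delta> = 0" .
    then show ?thesis using R(3,4) nz(1)[OF ss] by simp
  next
    assume ss: "same_sign (dot (cross r s) p) (dot (cross r s) q)"
    from nonneg_combination_zero[OF nonneg(1,2) R(2) this] have "\<alpha> = 0" "\<beta> = 0" .
    then show ?thesis using R'(3,4) nz(1)[OF ss] by simp
  next
    assume ss: "same_sign (dot (cross p q) r) (- dot (cross r s) q)"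
    have "\<alpha> * of_int (dot (cross p q) r) + \<delta> * of_int (- dot (cross r s) q) = 0"
      unfolding of_int_minus using R(3) by linarith
    from nonneg_combination_zero[OF nonneg(1,4) this ss] have "\<alpha> = 0" "\<delta> = 0" .
    then show ?thesis using R(1,4) nz(1)[OF ss] by simp
  next
    assume ss: "same_sign (dot (cross p q) r) (dot (cross r s) p)"
    have "\<beta> * of_int (dot (cross p q) r) + \<delta> * of_int (dot (cross r s) p) = 0" using R(4) by linarith
    from nonneg_combination_zero[OF nonneg(2,4) this ss] have "\<beta> = 0" "\<delta> = 0" .
    then show ?thesis using R(1,3) nz(1)[OF ss] by simp
  next
    assume ss: "same_sign (dot (cross p q) s) (dot (cross r s) q)"
    have "\<alpha> * of_int (dot (cross p q) s) + \<gamma> * of_int (dot (cross r s) q) = 0"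
      using R''(3) unfolding of_int_minus by linarith
    from nonneg_combination_zero[OF nonneg(1,3) this ss] have "\<alpha> = 0" "\<gamma> = 0" .
    then show ?thesis using R(1) R''(4) nz(1)[OF ss] by simp
  next
    assume ss: "same_sign (dot (cross p q) s) (- dot (cross r s) p)"
    have "\<beta> * of_int (dot (cross p q) s) + \<gamma> * of_int (- dot (cross r s) p) = 0"
      using R''(4) unfolding of_int_minus by linarith
    from nonneg_combination_zero[OF nonneg(2,3) this ss] have "\<beta> = 0" "\<gamma> = 0" .
    then show ?thesis using R(1) R''(3) nz(1)[OF ss] by simp
  qed
qed

lemma independent_three:
  assumes "\<alpha> *\<^sub>R to_vec p + \<beta> *\<^sub>R to_vec q = \<alpha>' *\<^sub>R to_vec p + \<gamma> *\<^sub>R to_vec r" "dot (cross p q) r \<noteq> 0"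
  shows "\<alpha> = \<alpha>' \<and> \<beta> = 0 \<and> \<gamma> = 0"
proof -
  \<comment> \<open>The common vector is collected on one side; the other side becomes a cone with
    \<open>r\<close> taken twice and the second coefficient zero, so that
    \<open>cone_relation\<close> applies.\<close>
  have "(\<alpha> - \<alpha>') *\<^sub>R to_vec p + \<beta> *\<^sub>R to_vec q = \<gamma> *\<^sub>R to_vec r + 0 *\<^sub>R to_vec r"
    using assms(1) by (simp add: algebra_simps)
  from cone_relation[OF this] show ?thesis using assms(2) by simp
qed

lemma independent_two:
  assumes "\<alpha> *\<^sub>R to_vec p + \<beta> *\<^sub>R to_vec q = \<alpha>' *\<^sub>R to_vec p + \<beta>' *\<^sub>R to_vec q" "cross p q \<noteq> (0, 0, 0)"
  shows "\<alpha> = \<alpha>' \<and> \<beta> = \<beta>'"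
proof -
  obtain n1 n2 n3 where n: "cross p q = (n1, n2, n3)" by (cases "cross p q")
  \<comment> \<open>Some unit vector is not orthogonal to the nonzero normal and completes
    \<open>p\<close> and \<open>q\<close> to a basis.\<close>
  then obtain r where "dot (cross p q) r \<noteq> 0" using assms(2) that[of "(1, 0, 0)"] that[of "(0, 1, 0)"] that[of "(0, 0, 1)"] by auto
  moreover have "\<alpha> *\<^sub>R to_vec p + (\<beta> - \<beta>') *\<^sub>R to_vec q = \<alpha>' *\<^sub>R to_vec p + 0 *\<^sub>R to_vec r"
    using assms(1) by (simp add: algebra_simps)
  ultimately have "\<alpha> = \<alpha>' \<and> \<beta> - \<beta>' = 0 \<and> (0::real) = 0" by (intro independent_three)
  then show ?thesis by simp
qed

lemma cross_orthogonal: "dot (cross p q) q = 0"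
  by (cases p; cases q) (simp add: algebra_simps)

abbreviation star_sum :: "point list \<Rightarrow> nat \<Rightarrow> (nat \<Rightarrow> real) \<Rightarrow> nat set \<Rightarrow> real^3" where
  "star_sum P v x S \<equiv> \<Sum>w\<in>S. x w *\<^sub>R (placement P w - placement P v)"

lemma star_sum_triangle:
  assumes "distinct [v, a, b]"
  shows "star_sum P v x {v, a, b} = x a *\<^sub>R to_vec (diff (P ! a) (P ! v)) + x b *\<^sub>R to_vec (diff (P ! b) (P ! v))"
proof -
  have "v \<notin> {a, b}" "a \<notin> {b}" using assms by auto
  then show ?thesis unfolding placement_diff[symmetric] by (simp del: insert_iff)
qed

text \<open>If the three edge vectors at \<open>v\<close> are independent, two cones with a common
  side meet only in that side.\<close>

lemma adjacent_triangles_injective: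
  assumes "distinct [v, a, b]" "distinct [v, a, d]"
    and eq: "star_sum P v x {v, a, b} = star_sum P v y {v, a, d}"
    and supp: "\<And>w. w \<notin> {v, a, b} \<Longrightarrow> x w = 0" "\<And>w. w \<notin> {v, a, d} \<Longrightarrow> y w = 0"
    and det: "dot (cross (diff (P ! a) (P ! v)) (diff (P ! b) (P ! v))) (diff (P ! d) (P ! v)) \<noteq> 0" and "u \<noteq> v"
  shows "x u = y u"
proof -
  have "x a = y a \<and> x b = 0 \<and> y d = 0"
    by (rule independent_three[OF eq[unfolded star_sum_triangle[OF assms(1)] star_sum_triangle[OF assms(2)]] det])
  moreover have "b \<noteq> d" using det cross_orthogonal by metis
  ultimately show ?thesis
    using supp(1)[of u] supp(2)[of u] supp(1)[of d] supp(2)[of b] assms(1,2) \<open>u \<noteq> v\<close>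
    by (cases "u \<in> {a, b, d}") auto
qed

text \<open>The four ways in which the link edges can share an endpoint reduce to one by exchanging
  the ends of an edge; disjoint link edges are settled by the sign conditions.\<close>

lemma separated_triangles_injective:
  assumes sep: "separated (cone P v (a, b)) (cone P v (c, d))"
    and dist: "distinct [v, a, b]" "distinct [v, c, d]"
    and nonneg: "\<And>w. 0 \<le> x w" "\<And>w. 0 \<le> y w"
    and eq: "star_sum P v x {v, a, b} = star_sum P v y {v, c, d}"
    and supp: "\<And>w. w \<notin> {v, a, b} \<Longrightarrow> x w = 0" "\<And>w. w \<notin> {v, c, d} \<Longrightarrow> y w = 0" and "u \<noteq> v"
  shows "x u = y u"
proof -
  let ?p = "diff (P ! a) (P ! v)" and ?q = "diff (P ! b) (P ! v)"
    and ?r = "diff (P ! c) (P ! v)" and ?s = "diff (P ! d) (P ! v)"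
  have swap: "{v, a, b} = {v, b, a}" "{v, c, d} = {v, d, c}" by auto
  consider "a = c" "dot (cross ?p ?q) ?s \<noteq> 0" | "b = c" "dot (cross ?p ?q) ?s \<noteq> 0"
    | "a = d" "dot (cross ?p ?q) ?r \<noteq> 0" | "b = d" "dot (cross ?p ?q) ?r \<noteq> 0"
    | "a \<noteq> c" "b \<noteq> c" "a \<noteq> d" "b \<noteq> d"
      "same_sign (dot (cross ?p ?q) ?r) (dot (cross ?p ?q) ?s) \<or> same_sign (dot (cross ?r ?s) ?p) (dot (cross ?r ?s) ?q)
        \<or> same_sign (dot (cross ?p ?q) ?r) (- dot (cross ?r ?s) ?q) \<or> same_sign (dot (cross ?p ?q) ?r) (dot (cross ?r ?s) ?p)
        \<or> same_sign (dot (cross ?p ?q) ?s) (dot (cross ?r ?s) ?q) \<or> same_sign (dot (cross ?p ?q) ?s) (- dot (cross ?r ?s) ?p)"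
    using sep unfolding cone_def Let_def prod.case separated.simps by (auto simp del: same_sign.simps split: if_splits)
  then show ?thesis
  proof cases
    case 1
    show ?thesis
    proof (rule adjacent_triangles_injective[OF _ _ eq[folded \<open>a = c\<close>] supp(1) supp(2)[folded \<open>a = c\<close>] _ \<open>u \<noteq> v\<close>])
      show "distinct [v, a, b]" "distinct [v, a, d]" using dist 1 by auto
      show "dot (cross (diff (P ! a) (P ! v)) (diff (P ! b) (P ! v))) (diff (P ! d) (P ! v)) \<noteq> 0"
        using 1(2) by (simp add: dot_cross_swap[of ?q ?p])
    qed
  next
    case 2
    show ?thesis
    proof (rule adjacent_triangles_injective[OF _ _ eq[unfolded swap(1), folded \<open>b = c\<close>] supp(1)[unfolded swap(1)] supp(2)[folded \<open>b = c\<close>] _ \<open>u \<noteq> v\<close>])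
      show "distinct [v, b, a]" "distinct [v, b, d]" using dist 2 by auto
      show "dot (cross (diff (P ! b) (P ! v)) (diff (P ! a) (P ! v))) (diff (P ! d) (P ! v)) \<noteq> 0"
        using 2(2) by (simp add: dot_cross_swap[of ?q ?p])
    qed
  next
    case 3
    show ?thesis
    proof (rule adjacent_triangles_injective[OF _ _ eq[unfolded swap(2), folded \<open>a = d\<close>] supp(1) supp(2)[unfolded swap(2), folded \<open>a = d\<close>] _ \<open>u \<noteq> v\<close>])
      show "distinct [v, a, b]" "distinct [v, a, c]" using dist 3 by auto
      show "dot (cross (diff (P ! a) (P ! v)) (diff (P ! b) (P ! v))) (diff (P ! c) (P ! v)) \<noteq> 0"
        using 3(2) by (simp add: dot_cross_swap[of ?q ?p])
    qed
  next
    case 4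
    show ?thesis
    proof (rule adjacent_triangles_injective[OF _ _ eq[unfolded swap(1) swap(2), folded \<open>b = d\<close>] supp(1)[unfolded swap(1)] supp(2)[unfolded swap(2), folded \<open>b = d\<close>] _ \<open>u \<noteq> v\<close>])
      show "distinct [v, b, a]" "distinct [v, b, c]" using dist 4 by auto
      show "dot (cross (diff (P ! b) (P ! v)) (diff (P ! a) (P ! v))) (diff (P ! c) (P ! v)) \<noteq> 0"
        using 4(2) by (simp add: dot_cross_swap[of ?q ?p])
    qed
  next
    case 5
    have "x a = 0 \<and> x b = 0 \<and> y c = 0 \<and> y d = 0"
      by (rule separated_cones[OF eq[unfolded star_sum_triangle[OF dist(1)] star_sum_triangle[OF dist(2)]]
          nonneg(1) nonneg(1) nonneg(2) nonneg(2) 5(5)])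
    moreover have "x u = 0" if "x a = 0" "x b = 0" using that supp(1)[of u] \<open>u \<noteq> v\<close> by (cases "u \<in> {a, b}") auto
    moreover have "y u = 0" if "y c = 0" "y d = 0" using that supp(2)[of u] \<open>u \<noteq> v\<close> by (cases "u \<in> {c, d}") auto
    ultimately show ?thesis by simp
  qed
qed

lemma all_separatedD:
  assumes "all_separated es" "e \<in> set es" "e' \<in> set es"
  shows "e = e' \<or> separated e e' \<or> separated e' e"
  using assms by (induction es) (auto simp: list_all_iff simp del: separated.simps)

lemma all_separated_nonzero:
  assumes "all_separated es" "e \<in> set es"
  shows "snd (snd (snd (snd e))) \<noteq> (0, 0, 0)"
  using assms by (induction es) auto

lemma link_edge_triangle:
  assumes "nondegenerate t" "v \<in> triangle_set t"
  obtains a b where "(a, b) \<in> set (link_edge v t)" "triangle_set t = {v, a, b}" "distinct [v, a, b]"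
  using assms by (cases t) (auto simp: insert_commute split: if_splits)

lemma polyhedral_realization_facets:
  assumes ok: "realizes P L" and nd: "\<And>t. t \<in> set L \<Longrightarrow> nondegenerate t" and lt: "\<Union>(facets L) \<subseteq> {..<9}"
  shows "polyhedral_realization (complex_of (facets L)) (placement P)"
proof (rule polyhedral_realization_if_stars_injective)
  show "finite (facets L)" by (simp add: facets_def)
  show "finite T" if "T \<in> facets L" for T using that by (auto simp: facets_def)
next
  fix v S T x y u
  assume ST: "S \<in> facets L" "T \<in> facets L" and v: "v \<in> S" "v \<in> T"
    and nonneg: "\<And>w. 0 \<le> x w" "\<And>w. 0 \<le> (y w :: real)"
    and supp: "\<And>w. w \<notin> S \<Longrightarrow> x w = 0" "\<And>w. w \<notin> T \<Longrightarrow> y w = 0"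
    and eq: "star_sum P v x S = star_sum P v y T" and u: "u \<noteq> v"
  obtain t t' where t: "t \<in> set L" "S = triangle_set t" "t' \<in> set L" "T = triangle_set t'"
    using ST by (auto simp: facets_def)
  obtain a b where ab: "(a, b) \<in> set (link_edge v t)" "S = {v, a, b}" "distinct [v, a, b]"
    using link_edge_triangle[of t v] t nd v by metis
  obtain c d where cd: "(c, d) \<in> set (link_edge v t')" "T = {v, c, d}" "distinct [v, c, d]"
    using link_edge_triangle[of t' v] t nd v by metis
  let ?es = "map (cone P v) (concat (map (link_edge v) L))"
  have "v < 9" using lt ST v by auto
  then have es: "all_separated ?es" using ok by (simp add: realizes_def list_all_iff)
  have mem: "cone P v (a, b) \<in> set ?es" "cone P v (c, d) \<in> set ?es" using t ab cd by auto
  note eq' = eq[unfolded ab(2) cd(2)]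
    and supp' = supp(1)[unfolded ab(2)] supp(2)[unfolded cd(2)]
  from all_separatedD[OF es mem] show "x u = y u"
  proof (elim disjE)
    assume "cone P v (a, b) = cone P v (c, d)"
    \<comment> \<open>A cone records its labels, so equal entries come from the same
      triangle.\<close>
    then have ac: "c = a" "d = b" by (auto simp: cone_def Let_def)
    have nz: "cross (diff (P ! a) (P ! v)) (diff (P ! b) (P ! v)) \<noteq> (0, 0, 0)"
      using all_separated_nonzero[OF es mem(1)] by (simp add: cone_def Let_def)
    have "x a = y a \<and> x b = y b"
      by (rule independent_two[OF eq'[unfolded ac star_sum_triangle[OF ab(3)]] nz])
    then show ?thesis
      using supp'(1)[of u] supp'(2)[of u] u unfolding ac by (cases "u = a"; cases "u = b") simp_all
  next
    assume "separated (cone P v (a, b)) (cone P v (c, d))"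
    then show ?thesis by (rule separated_triangles_injective[OF _ ab(3) cd(3) nonneg eq' supp' u])
  next
    assume "separated (cone P v (c, d)) (cone P v (a, b))"
    from separated_triangles_injective[OF this cd(3) ab(3) nonneg(2,1) eq'[symmetric] supp'(2,1) u]
    show ?thesis ..
  qed
qed


section \<open>Flips of triangle lists\<close>

definition grid_triangles :: "triangle list" where
  "grid_triangles =
   [(8, 6, 0), (8, 1, 0), (5, 3, 6), (5, 8, 6), (2, 0, 3), (2, 5, 3), (7, 8, 1), (7, 2, 1), (4, 5, 8),
    (4, 7, 8), (1, 2, 5), (1, 4, 5), (6, 7, 2), (6, 0, 2), (3, 4, 7), (3, 6, 7), (0, 1, 4), (0, 3, 4)]"

text \<open>A quadruple names the edge to remove and then the edge to insert. The checks are the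
  assumptions of \<open>edge_flip\<close>; without them the result could fail to triangulate the
  same surface.\<close>

fun flip :: "nat \<times> nat \<times> nat \<times> nat \<Rightarrow> triangle list \<Rightarrow> triangle list option" where
  "flip (a, c, b, d) L = (case filter (\<lambda>t. incident a t \<and> incident c t) L of
     [s, t] \<Rightarrow> if (incident b s \<and> incident d t \<or> incident d s \<and> incident b t) \<and> distinct [a, b, c, d]
        \<and> list_all (\<lambda>t. \<not> (incident b t \<and> incident d t)) L
      then Some ((b, a, d) # (b, d, c) # filter (\<lambda>t. \<not> (incident a t \<and> incident c t)) L) else None
   | _ \<Rightarrow> None)"

fun flips :: "(nat \<times> nat \<times> nat \<times> nat) list \<Rightarrow> triangle list \<Rightarrow> triangle list option" where
  "flips [] L = Some L"
| "flips (f # fs) L = (case flip f L of None \<Rightarrow> None | Some L' \<Rightarrow> flips fs L')"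

text \<open>The property handed along a flip sequence. The homeomorphism cannot be evaluated and is
  therefore part of it; the absence of repeated triangles lets sums over the list stand for sums
  over the facets.\<close>

definition klein_list :: "triangle list \<Rightarrow> bool" where
  "klein_list L \<longleftrightarrow> (\<forall>t\<in>set L. nondegenerate t) \<and> distinct (map triangle_set L) \<and> \<Union>(facets L) = {..<9} \<and>
     top_of_set (underlying_space (complex_of (facets L))) homeomorphic_space klein_bottle"

lemma triangle_set_eqI:
  assumes "nondegenerate t" "incident a t" "incident b t" "incident c t" "distinct [a, b, c]"
  shows "triangle_set t = {a, b, c}"
  using assms by (cases t) auto

lemma card_triangle_set: "nondegenerate t \<Longrightarrow> card (triangle_set t) = 3"
  by (cases t) auto

lemma facets_flip:
  assumes "filter (\<lambda>t. incident a t \<and> incident c t) L = [s, t]"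
  shows "facets L = {triangle_set s, triangle_set t} \<union> facets (filter (\<lambda>t. \<not> (incident a t \<and> incident c t)) L)"
proof -
  have "set L = set (filter (\<lambda>t. incident a t \<and> incident c t) L) \<union> set (filter (\<lambda>t. \<not> (incident a t \<and> incident c t)) L)"
    by auto
  then have "set L = {s, t} \<union> set (filter (\<lambda>t. \<not> (incident a t \<and> incident c t)) L)" by (simp only: assms) simp
  then show ?thesis unfolding facets_def by (simp only: image_Un) simp
qed

lemma klein_list_flip:
  assumes L: "klein_list L" and flip: "flip (a, c, b, d) L = Some L'"
  shows "klein_list L'"
proof -
  let ?M = "filter (\<lambda>t. \<not> (incident a t \<and> incident c t)) L"
  obtain s t where st: "filter (\<lambda>t. incident a t \<and> incident c t) L = [s, t]"
    using flip by (auto split: list.splits)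
  have b: "incident b s \<and> incident d t \<or> incident d s \<and> incident b t" and dist: "distinct [a, b, c, d]"
    and not_bd: "list_all (\<lambda>t. \<not> (incident b t \<and> incident d t)) L" and L': "L' = (b, a, d) # (b, d, c) # ?M"
    using flip by (simp_all add: st split: if_splits)
  have nd: "\<And>t. t \<in> set L \<Longrightarrow> nondegenerate t" using L by (simp add: klein_list_def)
  have mem: "s \<in> set L \<and> incident a s \<and> incident c s" "t \<in> set L \<and> incident a t \<and> incident c t"
    using arg_cong[OF st, of set] by auto
  have "{triangle_set s, triangle_set t} = {{a, b, c}, {a, c, d}}"
    using b
  proof
    assume "incident b s \<and> incident d t"
    then have "triangle_set s = {a, b, c}" "triangle_set t = {a, c, d}"
      using triangle_set_eqI[of s a b c] triangle_set_eqI[of t a c d] nd mem dist by auto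
    then show ?thesis by simp
  next
    assume "incident d s \<and> incident b t"
    then have "triangle_set s = {a, c, d}" "triangle_set t = {a, b, c}"
      using triangle_set_eqI[of s a c d] triangle_set_eqI[of t a b c] nd mem dist by auto
    then show ?thesis by auto
  qed
  then have F: "facets L = {{a, b, c}, {a, c, d}} \<union> facets ?M" using facets_flip[OF st] by simp
  have F': "facets L' = {{b, a, d}, {b, d, c}} \<union> facets ?M" by (simp add: L' facets_def)
  have bd: "\<not> (b \<in> T \<and> d \<in> T)" if "T \<in> facets ?M" for T
    using that not_bd by (auto simp: facets_def triangle_set_def list_all_iff)
  have ef: "edge_flip a b c d (facets ?M) (facets L) (facets L')"
  proof
    show "distinct [a, b, c, d]" by (rule dist)
    show "finite T" if "T \<in> facets ?M" for T
      using that by (auto simp: facets_def)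
    show "\<not> (a \<in> T \<and> c \<in> T)" if "T \<in> facets ?M" for T
      using that by (auto simp: facets_def triangle_set_def)
  qed (fact F F' bd | simp add: facets_def)+
  have "distinct (map triangle_set ?M)"
    using L by (simp add: klein_list_def distinct_map_filter)
  \<comment> \<open>Both new triangles contain \<open>b\<close> and \<open>d\<close>, which no
    remaining triangle does.\<close>
  moreover have "{b, a, d} \<notin> triangle_set ` set ?M" "{b, d, c} \<notin> triangle_set ` set ?M"
    using bd[of "{b, a, d}"] bd[of "{b, d, c}"] by (auto simp: facets_def)
  moreover have "{b, a, d} \<noteq> {b, d, c}" using dist by auto
  ultimately have "distinct (map triangle_set L')" unfolding L' by simp
  moreover have "\<forall>t\<in>set L'. nondegenerate t" using nd dist by (auto simp: L')
  moreover have "\<Union>(facets L') = {..<9}"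
    using edge_flip.same_vertices[OF ef] L by (simp add: klein_list_def)
  moreover have "top_of_set (underlying_space (complex_of (facets L'))) homeomorphic_space klein_bottle"
    using edge_flip_homeomorphic[OF ef] L homeomorphic_space_sym homeomorphic_space_trans
    unfolding klein_list_def by blast
  ultimately show ?thesis by (simp add: klein_list_def)
qed

lemma klein_list_flips: "klein_list L \<Longrightarrow> flips fs L = Some L' \<Longrightarrow> klein_list L'"
  by (induction fs L rule: flips.induct) (auto split: option.splits dest: klein_list_flip)

lemma facets_grid_triangles: "facets grid_triangles = grid_facets"
proof -
  have "{..<3::nat} = {0, 1, 2}" by auto
  then show ?thesis
    by (simp add: facets_def grid_triangles_def grid_facets_def grid_label_def numeral_2_eq_2)
qed

text \<open>An inclusion of vertex sets, which amounts to equality for nondegenerate triangles and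
  ignores the order of the entries.\<close>

fun same_triangle :: "triangle \<Rightarrow> triangle \<Rightarrow> bool" where
  "same_triangle t (a, b, c) \<longleftrightarrow> incident a t \<and> incident b t \<and> incident c t"

fun no_repetition :: "triangle list \<Rightarrow> bool" where
  "no_repetition [] \<longleftrightarrow> True"
| "no_repetition (t # ts) \<longleftrightarrow> \<not> list_ex (same_triangle t) ts \<and> no_repetition ts"

lemma same_triangle_if_eq: "triangle_set s = triangle_set t \<Longrightarrow> same_triangle s t"
  by (cases t) (auto simp: triangle_set_def)

lemma distinct_if_no_repetition: "no_repetition L \<Longrightarrow> distinct (map triangle_set L)"
  by (induction L) (auto simp: list_ex_iff dest: same_triangle_if_eq)

lemma klein_list_grid_triangles: "klein_list grid_triangles"
proof -
  have "list_all nondegenerate grid_triangles" by code_simp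
  moreover have "no_repetition grid_triangles" by code_simp
  then have "distinct (map triangle_set grid_triangles)" by (rule distinct_if_no_repetition)
  ultimately show ?thesis
    using grid_triangulation Union_grid_facets by (simp add: klein_list_def facets_grid_triangles list_all_iff)
qed

lemma klein_list_triangulation:
  assumes "klein_list L"
  shows "complex_of (facets L) \<in> klein_bottle_triangulations 9"
proof -
  have card: "card T = 3" if "T \<in> facets L" for T
    using assms that card_triangle_set by (auto simp: klein_list_def facets_def)
  moreover have "finite T" if "T \<in> facets L" for T using card[OF that] card_ge_0_finite[of T] by simp
  moreover have "finite (facets L)" by (simp add: facets_def)
  moreover have "0 \<in> \<Union>(facets L)" using assms by (simp add: klein_list_def)
  then have "facets L \<noteq> {}" by auto
  ultimately show ?thesis
    using assms unfolding klein_bottle_triangulations_def klein_bottle_triangulation_def klein_list_def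
    by (simp add: vertices_complex_of abstract_complex_complex_of two_dimensional_complex_of)
qed

lemma klein_list_realization:
  assumes "klein_list L" "realizes P L"
  shows "polyhedral_realization (complex_of (facets L)) (placement P)"
  using assms by (intro polyhedral_realization_facets) (auto simp: klein_list_def)


section \<open>An isomorphism invariant\<close>

definition two_faces :: "'v set set \<Rightarrow> 'v set set" where
  "two_faces \<Delta> = {T \<in> \<Delta>. card T = 3}"

definition face_degree :: "'v set set \<Rightarrow> 'v \<Rightarrow> int" where
  "face_degree \<Delta> v = int (card {T \<in> two_faces \<Delta>. v \<in> T})"

definition vertex_weight :: "'v set set \<Rightarrow> 'v \<Rightarrow> int" where
  "vertex_weight \<Delta> v = (\<Sum>T | T \<in> two_faces \<Delta> \<and> v \<in> T. \<Prod>u\<in>T. face_degree \<Delta> u)"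

text \<open>The products of degrees and the square record how the degrees are distributed over
  neighbouring triangles, not only which degrees occur.\<close>

definition invariant :: "'v set set \<Rightarrow> int" where
  "invariant \<Delta> = (\<Sum>T\<in>two_faces \<Delta>. (\<Sum>v\<in>T. vertex_weight \<Delta> v)\<^sup>2)"

lemma invariant_iso:
  assumes "complex_iso \<Delta> \<Delta>' f"
  shows "invariant \<Delta> = invariant \<Delta>'"
proof -
  have inj: "inj_on f (vertices \<Delta>)" and image: "(`) f ` \<Delta> = \<Delta>'"
    using assms by (auto simp: complex_iso_def bij_betw_def)
  have sub: "T \<subseteq> vertices \<Delta>" if "T \<in> \<Delta>" for T using that by (auto simp: vertices_def)
  have inj_T: "inj_on f T" if "T \<in> two_faces \<Delta>" for T
    using that inj_on_subset[OF inj sub] by (simp add: two_faces_def)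
  have inj_image: "inj_on ((`) f) \<Delta>"
    using inj_on_image_eq_iff[OF inj] sub by (auto simp: inj_on_def)
  have card: "card (f ` T) = card T" if "T \<in> \<Delta>" for T
    by (rule card_image) (rule inj_on_subset[OF inj sub[OF that]])
  have faces: "two_faces \<Delta>' = (`) f ` two_faces \<Delta>"
    unfolding two_faces_def image[symmetric] using card by auto
  have star: "{T \<in> two_faces \<Delta>'. f v \<in> T} = (`) f ` {T \<in> two_faces \<Delta>. v \<in> T}" if "v \<in> vertices \<Delta>" for v
    unfolding faces using inj_on_image_mem_iff[OF inj that] sub by (auto simp: two_faces_def)
  have inj_faces: "inj_on ((`) f) A" if "A \<subseteq> two_faces \<Delta>" for A
    by (rule inj_on_subset[OF inj_image]) (use that in \<open>auto simp: two_faces_def\<close>)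
  have deg: "face_degree \<Delta>' (f v) = face_degree \<Delta> v" if "v \<in> vertices \<Delta>" for v
    unfolding face_degree_def star[OF that] by (subst card_image) (auto intro!: inj_faces)
  have in_vertices: "v \<in> vertices \<Delta>" if "T \<in> two_faces \<Delta>" "v \<in> T" for v T
    using that sub by (auto simp: two_faces_def)
  have weight: "vertex_weight \<Delta>' (f v) = vertex_weight \<Delta> v" if "v \<in> vertices \<Delta>" for v
  proof -
    have "vertex_weight \<Delta>' (f v) = (\<Sum>T | T \<in> two_faces \<Delta> \<and> v \<in> T. \<Prod>u\<in>f ` T. face_degree \<Delta>' u)"
      unfolding vertex_weight_def star[OF that] by (subst sum.reindex) (auto intro!: inj_faces)
    also have "\<dots> = vertex_weight \<Delta> v"
      unfolding vertex_weight_def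
      by (intro sum.cong refl) (auto simp: prod.reindex[OF inj_T] deg in_vertices intro!: prod.cong)
    finally show ?thesis .
  qed
  have "invariant \<Delta>' = (\<Sum>T\<in>two_faces \<Delta>. (\<Sum>v\<in>f ` T. vertex_weight \<Delta>' v)\<^sup>2)"
    unfolding invariant_def faces by (subst sum.reindex) (auto intro!: inj_faces)
  also have "\<dots> = invariant \<Delta>"
    unfolding invariant_def
    by (intro sum.cong refl arg_cong[where f = "\<lambda>x. x\<^sup>2"])
       (auto simp: sum.reindex[OF inj_T] weight in_vertices intro!: sum.cong)
  finally show ?thesis ..
qed

definition key :: "triangle list \<Rightarrow> int" where
  "key L = (let
      d = map (\<lambda>v. int (length (filter (incident v) L))) [0..<9];
      w = map (\<lambda>v. \<Sum>(a, b, c)\<leftarrow>filter (incident v) L. d ! a * d ! b * d ! c) [0..<9]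
    in \<Sum>(a, b, c)\<leftarrow>L. (w ! a + w ! b + w ! c)\<^sup>2)"

lemma two_faces_klein_list:
  assumes "klein_list L"
  shows "two_faces (complex_of (facets L)) = facets L"
  unfolding two_faces_def
  by (rule facets_complex_of) (use assms card_triangle_set in \<open>auto simp: klein_list_def facets_def\<close>)

text \<open>With constant \<open>g\<close> this evaluates the degrees, with the product of degrees
  the vertex weights.\<close>

lemma sum_list_filter_triangles:
  fixes g :: "nat set \<Rightarrow> int"
  assumes "distinct (map triangle_set L)"
  shows "(\<Sum>t\<leftarrow>filter (incident v) L. g (triangle_set t)) = (\<Sum>T | T \<in> facets L \<and> v \<in> T. g T)"
proof -
  have "distinct (map triangle_set (filter (incident v) L))" using assms by (simp add: distinct_map_filter)
  then have "(\<Sum>t\<leftarrow>filter (incident v) L. g (triangle_set t)) = sum g (set (map triangle_set (filter (incident v) L)))"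
    by (simp add: sum_list_distinct_conv_sum_set[symmetric] o_def del: set_map)
  also have "set (map triangle_set (filter (incident v) L)) = {T. T \<in> facets L \<and> v \<in> T}"
    by (auto simp: facets_def triangle_set_def)
  finally show ?thesis .
qed

lemma key_eq_invariant:
  assumes L: "klein_list L"
  shows "key L = invariant (complex_of (facets L))"
proof -
  let ?\<Delta> = "complex_of (facets L)"
  note tf = two_faces_klein_list[OF L]
  have dist: "distinct (map triangle_set L)" and nd: "\<And>t. t \<in> set L \<Longrightarrow> nondegenerate t"
    and V: "\<Union>(facets L) = {..<9}" using L by (auto simp: klein_list_def)
  \<comment> \<open>Lookups in the tables \<open>d\<close> and \<open>w\<close> are meaningful only
    for labels below 9.\<close>
  have lt: "a < 9 \<and> b < 9 \<and> c < 9 \<and> distinct [a, b, c]" if "(a, b, c) \<in> set L" for a b c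
  proof -
    have "{a, b, c} \<in> facets L" using that by (force simp: facets_def)
    then show ?thesis using V nd[OF that] by auto
  qed
  have deg: "int (length (filter (incident v) L)) = face_degree ?\<Delta> v" for v
    using sum_list_filter_triangles[OF dist, of "\<lambda>_. 1" v]
    by (simp add: face_degree_def tf sum_list_triv)
  have weight: "(\<Sum>(a, b, c)\<leftarrow>filter (incident v) L. face_degree ?\<Delta> a * face_degree ?\<Delta> b * face_degree ?\<Delta> c)
      = vertex_weight ?\<Delta> v" for v
  proof -
    have "(\<Sum>(a, b, c)\<leftarrow>filter (incident v) L. face_degree ?\<Delta> a * face_degree ?\<Delta> b * face_degree ?\<Delta> c)
      = (\<Sum>t\<leftarrow>filter (incident v) L. \<Prod>u\<in>triangle_set t. face_degree ?\<Delta> u)"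
      by (intro arg_cong[where f = sum_list] map_cong refl) (use lt in \<open>auto simp: mult.assoc\<close>)
    then show ?thesis unfolding vertex_weight_def tf sum_list_filter_triangles[OF dist] .
  qed
  define d where "d = map (\<lambda>v. int (length (filter (incident v) L))) [0..<9]"
  define w where "w = map (\<lambda>v. \<Sum>(a, b, c)\<leftarrow>filter (incident v) L. d ! a * d ! b * d ! c) [0..<9]"
  have d: "d ! v = face_degree ?\<Delta> v" if "v < 9" for v using that by (simp add: d_def deg)
  have "(\<Sum>(a, b, c)\<leftarrow>filter (incident v) L. d ! a * d ! b * d ! c)
    = (\<Sum>(a, b, c)\<leftarrow>filter (incident v) L. face_degree ?\<Delta> a * face_degree ?\<Delta> b * face_degree ?\<Delta> c)" for v
    by (intro arg_cong[where f = sum_list] map_cong refl) (use lt in \<open>auto simp: d\<close>)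
  then have w: "w ! v = vertex_weight ?\<Delta> v" if "v < 9" for v using that by (simp add: w_def weight)
  have "key L = (\<Sum>(a, b, c)\<leftarrow>L. (w ! a + w ! b + w ! c)\<^sup>2)"
    by (simp only: key_def Let_def d_def w_def)
  also have "\<dots> = (\<Sum>t\<leftarrow>L. (\<Sum>u\<in>triangle_set t. vertex_weight ?\<Delta> u)\<^sup>2)"
    by (intro arg_cong[where f = sum_list] map_cong refl) (use lt in \<open>auto simp: w add.assoc\<close>)
  also have "\<dots> = (\<Sum>T\<in>facets L. (\<Sum>u\<in>T. vertex_weight ?\<Delta> u)\<^sup>2)"
    using sum_list_distinct_conv_sum_set[OF dist, of "\<lambda>T. (\<Sum>u\<in>T. vertex_weight ?\<Delta> u)\<^sup>2"]
    by (simp add: facets_def o_def)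
  finally show ?thesis by (simp add: invariant_def tf)
qed

section \<open>Counting isomorphism classes\<close>

lemma card_classes_ge:
  assumes Ls: "\<And>L. L \<in> set Ls \<Longrightarrow> klein_list L \<and> Q (complex_of (facets L))"
    and keys: "distinct (map key Ls)"
  shows "length Ls \<le> card {C \<in> klein_bottle_triangulation_classes 9. \<exists>\<Delta>\<in>C. Q \<Delta>}"
proof -
  define R where "R = {(\<Delta>, \<Delta>'). \<Delta> \<in> klein_bottle_triangulations 9 \<and> \<Delta>' \<in> klein_bottle_triangulations 9
    \<and> isomorphic_complexes \<Delta> \<Delta>'}"
  have classes: "klein_bottle_triangulation_classes 9 = klein_bottle_triangulations 9 // R"
    by (simp add: klein_bottle_triangulation_classes_def R_def)
  \<comment> \<open>Finiteness matters because an infinite set has \<open>card\<close> 0. It holds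
    since the vertices are labelled by a fixed finite set.\<close>
  have "klein_bottle_triangulations 9 \<subseteq> Pow (Pow {..<9})"
    by (auto simp: klein_bottle_triangulations_def vertices_def)
  then have fin: "finite (klein_bottle_triangulation_classes 9)"
    unfolding classes by (intro finite_quotient) (auto simp: R_def intro: finite_subset)
  let ?cl = "\<lambda>L. R `` {complex_of (facets L)}"
  have tri: "complex_of (facets L) \<in> klein_bottle_triangulations 9" if "L \<in> set Ls" for L
    using Ls[OF that] klein_list_triangulation by blast
  have "complex_iso \<Delta> \<Delta> id" for \<Delta> :: "nat set set" by (simp add: complex_iso_def)
  then have refl: "complex_of (facets L) \<in> ?cl L" if "L \<in> set Ls" for L
    using tri[OF that] by (auto simp: R_def isomorphic_complexes_def)
  \<comment> \<open>A complex lies in its own class, so equal classes yield an isomorphism and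
    thereby equal keys.\<close>
  have "inj_on ?cl (set Ls)"
  proof (rule inj_onI)
    fix L M assume LM: "L \<in> set Ls" "M \<in> set Ls" "?cl L = ?cl M"
    then have "complex_of (facets M) \<in> ?cl L" using refl by blast
    then obtain f where "complex_iso (complex_of (facets L)) (complex_of (facets M)) f"
      by (auto simp: R_def isomorphic_complexes_def)
    then have "key L = key M" using invariant_iso key_eq_invariant Ls LM by metis
    then show "L = M" using keys LM by (auto simp: distinct_map inj_on_def)
  qed
  then have "card (?cl ` set Ls) = length Ls"
    using keys by (simp add: card_image distinct_map distinct_card)
  moreover have sub: "?cl ` set Ls \<subseteq> {C \<in> klein_bottle_triangulation_classes 9. \<exists>\<Delta>\<in>C. Q \<Delta>}"
  proof
    fix C assume "C \<in> ?cl ` set Ls"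
    then obtain L where L: "L \<in> set Ls" "C = ?cl L" by auto
    then have "C \<in> klein_bottle_triangulation_classes 9" using tri[OF L(1)] unfolding classes by (simp add: quotientI)
    moreover have "complex_of (facets L) \<in> C" unfolding L(2) by (rule refl[OF L(1)])
    moreover have "Q (complex_of (facets L))" using Ls[OF L(1)] by blast
    ultimately show "C \<in> {C \<in> klein_bottle_triangulation_classes 9. \<exists>\<Delta>\<in>C. Q \<Delta>}" by blast
  qed
  ultimately show ?thesis using card_mono[OF _ sub] fin by simp
qed


section \<open>Rotational symmetry\<close>

text \<open>The third coordinate axis serves as the axis of every symmetric realization, which keeps
  all coordinates integral.\<close>

fun half_turn_point :: "point \<Rightarrow> point" where
  "half_turn_point (x, y, z) = (- x, - y, z)"

definition half_turn_matrix :: "real^3^3" where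
  "half_turn_matrix = vector [vector [-1, 0, 0], vector [0, -1, 0], vector [0, 0, 1]]"

definition half_turn :: "real^3 \<Rightarrow> real^3" where
  "half_turn x = half_turn_matrix *v x"

lemma half_turn_nth:
  "half_turn x $ 1 = - x $ 1" "half_turn x $ 2 = - x $ 2" "half_turn x $ 3 = x $ 3"
  by (simp_all add: half_turn_def half_turn_matrix_def matrix_vector_mult_def sum_3)

lemma half_turn_to_vec: "half_turn (to_vec p) = to_vec (half_turn_point p)"
  by (cases p) (simp add: vec_eq_iff forall_3 half_turn_nth)

lemma half_turn_half_turn: "half_turn (half_turn x) = x"
  by (simp add: vec_eq_iff forall_3 half_turn_nth)

lemma linear_half_turn: "linear half_turn"
  unfolding half_turn_def[abs_def] by (rule matrix_vector_mul_linear)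

lemma isometry_half_turn: "isometry_of_space half_turn"
  unfolding isometry_of_space_def
proof (intro conjI allI)
  show "bij half_turn" by (rule involuntory_imp_bij) (rule half_turn_half_turn)
  show "dist (half_turn x) (half_turn y) = dist x y" for x y
    by (simp add: dist_norm norm_eq_sqrt_inner inner_vec_def sum_3 half_turn_nth power2_commute
        flip: power2_eq_square)
qed

lemma order_two_rotation_half_turn: "order_two_rotation half_turn"
  unfolding order_two_rotation_def
proof (intro conjI)
  have "orthogonal_matrix half_turn_matrix"
    by (simp add: orthogonal_matrix half_turn_matrix_def matrix_matrix_mult_def transpose_def mat_def
        vec_eq_iff forall_3 sum_3)
  moreover have "det half_turn_matrix = 1" by (simp add: det_3 half_turn_matrix_def)
  ultimately have "rotation_matrix half_turn_matrix" by (simp add: rotation_matrix_def)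
  moreover have "half_turn_matrix *v axis 3 1 = axis 3 1"
    unfolding half_turn_def[symmetric] by (simp add: vec_eq_iff forall_3 half_turn_nth axis_def)
  moreover have "axis 3 1 \<noteq> (0 :: real^3)" by (simp add: axis_eq_0_iff)
  ultimately have "rotation_about_line half_turn 0 (axis 3 1)"
    unfolding rotation_about_line_def half_turn_def[abs_def] by auto
  then show "\<exists>a d. rotation_about_line half_turn a d" by blast
  have "half_turn (axis 1 1) $ 1 \<noteq> axis 1 1 $ 1" by (simp add: half_turn_nth axis_def)
  then show "half_turn \<noteq> id" by auto
  show "half_turn \<circ> half_turn = id" by (simp add: fun_eq_iff half_turn_half_turn)
qed

text \<open>\<open>A\<close> lists the images of the vertices. Being an involution makes it a
  bijection and its own inverse, so it is enough to check that triangles go to triangles.\<close>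

definition rotation_symmetric :: "nat list \<Rightarrow> point list \<Rightarrow> triangle list \<Rightarrow> bool" where
  "rotation_symmetric A P L \<longleftrightarrow>
     list_all (\<lambda>v. A ! v < 9 \<and> A ! (A ! v) = v \<and> P ! (A ! v) = half_turn_point (P ! v)) [0..<9] \<and>
     list_all (\<lambda>(a, b, c). list_ex (\<lambda>t. same_triangle t (A ! a, A ! b, A ! c)) L) L \<and>
     list_ex (\<lambda>v. A ! v \<noteq> v) [0..<9]"

lemma triangle_set_if_same:
  assumes "same_triangle t (a, b, c)" "nondegenerate t" "distinct [a, b, c]"
  shows "triangle_set t = {a, b, c}"
  using assms triangle_set_eqI by auto

text \<open>The half-turn is linear, so its agreement with the permutation on the nine vertex
  positions extends to all points of the image.\<close>

lemma twofold_rotational_symmetry: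
  assumes L: "klein_list L" and sym: "rotation_symmetric A P L"
  shows "has_twofold_rotational_symmetry (complex_of (facets L)) (placement P)"
proof -
  let ?\<Delta> = "complex_of (facets L)" and ?\<alpha> = "\<lambda>v. A ! v" and ?V = "{..<9::nat}"
  let ?f = "simplexwise_linear ?\<Delta> (placement P)" and ?X = "underlying_space ?\<Delta>"
  have V: "\<Union>(facets L) = ?V" using L by (simp add: klein_list_def)
  then have vertices: "vertices ?\<Delta> = ?V" by (simp add: vertices_complex_of)
  have \<alpha>: "?\<alpha> v < 9" "?\<alpha> (?\<alpha> v) = v" "placement P (?\<alpha> v) = half_turn (placement P v)" if "v < 9" for v
    using sym that by (auto simp: rotation_symmetric_def list_all_iff placement_def half_turn_to_vec)
  have inj: "inj_on ?\<alpha> ?V" by (rule inj_on_inverseI[of _ ?\<alpha>]) (simp add: \<alpha>)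
  have bij: "bij_betw ?\<alpha> ?V ?V"
    by (rule bij_betw_byWitness[of _ ?\<alpha>]) (auto simp: \<alpha>)
  have facet_image: "?\<alpha> ` T \<in> facets L" if T: "T \<in> facets L" for T
  proof -
    obtain s where s: "s \<in> set L" "T = triangle_set s" using T unfolding facets_def by blast
    obtain a b c where "s = (a, b, c)" by (cases s)
    then have t: "(a, b, c) \<in> set L" "T = {a, b, c}" using s by simp_all
    have abc: "a < 9" "b < 9" "c < 9" using V T t by auto
    have "distinct [a, b, c]" using L t(1) by (auto simp: klein_list_def)
    then have "distinct [?\<alpha> a, ?\<alpha> b, ?\<alpha> c]" using inj_on_eq_iff[OF inj] abc by simp
    moreover obtain t where "t \<in> set L" "same_triangle t (?\<alpha> a, ?\<alpha> b, ?\<alpha> c)"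
      using sym t(1) unfolding rotation_symmetric_def list_all_iff list_ex_iff by fastforce
    moreover have "nondegenerate t" using L \<open>t \<in> set L\<close> by (simp add: klein_list_def)
    ultimately have "triangle_set t = ?\<alpha> ` T" unfolding t(2) by (simp add: triangle_set_if_same del: same_triangle.simps)
    then show ?thesis using \<open>t \<in> set L\<close> by (auto simp: facets_def)
  qed
  have sub_V: "\<sigma> \<subseteq> ?V" if "\<sigma> \<in> ?\<Delta>" for \<sigma>
    using that V unfolding complex_of_def by blast
  have image_in: "?\<alpha> ` \<sigma> \<in> ?\<Delta>" if \<sigma>: "\<sigma> \<in> ?\<Delta>" for \<sigma>
  proof -
    obtain T where "T \<in> facets L" "\<sigma> \<subseteq> T" "\<sigma> \<noteq> {}" using \<sigma> unfolding complex_of_def by blast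
    then have "?\<alpha> ` T \<in> facets L" "?\<alpha> ` \<sigma> \<subseteq> ?\<alpha> ` T" "?\<alpha> ` \<sigma> \<noteq> {}" using facet_image by auto
    then show ?thesis unfolding complex_of_def by blast
  qed
  have twice: "?\<alpha> ` ?\<alpha> ` \<sigma> = \<sigma>" if "\<sigma> \<subseteq> ?V" for \<sigma>
    using that by (force simp: image_image \<alpha> subset_iff)
  have "(\<lambda>\<sigma>. ?\<alpha> ` \<sigma>) ` ?\<Delta> = ?\<Delta>"
  proof
    show "?\<Delta> \<subseteq> (\<lambda>\<sigma>. ?\<alpha> ` \<sigma>) ` ?\<Delta>"
    proof
      fix \<sigma> assume \<sigma>: "\<sigma> \<in> ?\<Delta>"
      show "\<sigma> \<in> (\<lambda>\<sigma>. ?\<alpha> ` \<sigma>) ` ?\<Delta>"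
        by (rule image_eqI[where x = "?\<alpha> ` \<sigma>"]) (simp_all only: twice[OF sub_V[OF \<sigma>]] image_in[OF \<sigma>])
    qed
  qed (use image_in in blast)
  then have auto: "complex_automorphism ?\<Delta> ?\<alpha>"
    using bij by (simp add: complex_iso_def vertices)
  \<comment> \<open>The permutation is its own inverse, so the fibre over \<open>w\<close> is the
    single vertex \<open>A ! w\<close>; labels from 9 on have an empty fibre.\<close>
  have induced: "induced_map ?\<Delta> ?\<alpha> x w = (if w < 9 then x (?\<alpha> w) else 0)" for x w
  proof -
    have "{v. v \<in> ?V \<and> ?\<alpha> v = w} = (if w < 9 then {?\<alpha> w} else {})"
      using \<alpha> by auto
    then show ?thesis unfolding induced_map_def vertices by simp
  qed
  have f: "?f x = (\<Sum>v<9. x v *\<^sub>R placement P v)" for x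
    by (simp add: simplexwise_linear_complex_of V)
  have equivariant: "half_turn (?f x) = ?f (induced_map ?\<Delta> ?\<alpha> x)" for x
  proof -
    have "half_turn (?f x) = (\<Sum>v<9. x v *\<^sub>R half_turn (placement P v))"
      unfolding f by (simp add: linear_sum[OF linear_half_turn] linear_scale[OF linear_half_turn])
    \<comment> \<open>Writing \<open>v\<close> as the image of its image prepares the sum for
      reindexing along the permutation.\<close>
    also have "\<dots> = (\<Sum>v<9. x (?\<alpha> (?\<alpha> v)) *\<^sub>R placement P (?\<alpha> v))"
      by (intro sum.cong refl) (simp add: \<alpha>)
    also have "\<dots> = (\<Sum>v<9. x (?\<alpha> v) *\<^sub>R placement P v)"
      using sum.reindex_bij_betw[OF bij, of "\<lambda>w. x (?\<alpha> w) *\<^sub>R placement P w"] .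
    also have "\<dots> = ?f (induced_map ?\<Delta> ?\<alpha> x)"
      unfolding f by (intro sum.cong refl) (simp add: induced)
    finally show ?thesis .
  qed
  \<comment> \<open>Points are functions on all natural numbers; their values at labels from 9 on
    vanish, as do those of the induced map.\<close>
  have outside: "x v = 0" if "x \<in> ?X" "\<not> v < 9" for x v
  proof -
    obtain T where "T \<in> facets L" "\<And>v. v \<notin> T \<Longrightarrow> x v = 0"
      using \<open>x \<in> ?X\<close> unfolding underlying_space_complex_of by blast
    then show ?thesis using V that(2) by blast
  qed
  have induced_in: "induced_map ?\<Delta> ?\<alpha> x \<in> ?X" if x: "x \<in> ?X" for x
    unfolding underlying_space_complex_of
  proof (intro conjI allI)
    obtain T where T: "T \<in> facets L" "\<And>v. v \<notin> T \<Longrightarrow> x v = 0"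
      and nn: "\<And>v. 0 \<le> x v" and sum1: "(\<Sum>v\<in>\<Union>(facets L). x v) = 1"
      using x unfolding underlying_space_complex_of by blast
    show "0 \<le> induced_map ?\<Delta> ?\<alpha> x v" for v by (simp add: induced nn)
    have "induced_map ?\<Delta> ?\<alpha> x v = 0" if v: "v \<notin> ?\<alpha> ` T" for v
    proof (cases "v < 9")
      case True
      have "?\<alpha> v \<notin> T"
      proof
        assume "?\<alpha> v \<in> T"
        then have "?\<alpha> (?\<alpha> v) \<in> ?\<alpha> ` T" by (rule imageI)
        then show False using v \<alpha>(2)[OF True] by simp
      qed
      then show ?thesis using T(2) by (simp add: induced)
    qed (simp add: induced)
    then show "\<exists>T\<in>facets L. \<forall>v. v \<notin> T \<longrightarrow> induced_map ?\<Delta> ?\<alpha> x v = 0"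
      using facet_image[OF T(1)] by blast
    have "(\<Sum>v<9. induced_map ?\<Delta> ?\<alpha> x v) = (\<Sum>v<9. x (?\<alpha> v))"
      by (intro sum.cong refl) (simp add: induced)
    also have "\<dots> = (\<Sum>v<9. x v)" by (rule sum.reindex_bij_betw[OF bij])
    finally show "(\<Sum>v\<in>\<Union>(facets L). induced_map ?\<Delta> ?\<alpha> x v) = 1" using sum1 by (simp add: V)
  qed
  have induced_twice: "induced_map ?\<Delta> ?\<alpha> (induced_map ?\<Delta> ?\<alpha> x) = x" if "x \<in> ?X" for x
  proof
    show "induced_map ?\<Delta> ?\<alpha> (induced_map ?\<Delta> ?\<alpha> x) v = x v" for v
      using outside[OF that, of v] by (simp add: induced \<alpha>)
  qed
  have onto: "induced_map ?\<Delta> ?\<alpha> ` ?X = ?X"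
  proof
    show "?X \<subseteq> induced_map ?\<Delta> ?\<alpha> ` ?X"
    proof
      fix x assume "x \<in> ?X"
      then show "x \<in> induced_map ?\<Delta> ?\<alpha> ` ?X"
        using induced_in induced_twice by (metis image_eqI)
    qed
  qed (use induced_in in blast)
  have "half_turn ` ?f ` ?X = ?f ` induced_map ?\<Delta> ?\<alpha> ` ?X"
    by (simp only: image_image equivariant)
  then have "half_turn ` ?f ` ?X = ?f ` ?X" by (simp only: onto)
  then have "geometric_symmetry_induced_by ?\<Delta> (placement P) half_turn ?\<alpha>"
    unfolding geometric_symmetry_induced_by_def using isometry_half_turn auto equivariant by blast
  moreover have "\<exists>v\<in>vertices ?\<Delta>. ?\<alpha> v \<noteq> v"
    using sym unfolding vertices rotation_symmetric_def list_ex_iff by auto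
  ultimately show ?thesis
    unfolding has_twofold_rotational_symmetry_def using order_two_rotation_half_turn by blast
qed


section \<open>The realizations\<close>

text \<open>A triangulation is encoded by a sequence of flips leading to it from the grid. The value \<open>0\<close> marks an inadmissible
  flip or a violated condition \<open>C\<close>.\<close>

definition certified_key :: "(triangle list \<Rightarrow> bool) \<Rightarrow> (nat \<times> nat \<times> nat \<times> nat) list \<Rightarrow> int" where
  "certified_key C fs = (case flips fs grid_triangles of None \<Rightarrow> 0 | Some L \<Rightarrow> if C L then key L else 0)"

text \<open>Started at 0, one chain of comparisons shows that all keys are positive, hence that no
  certificate failed, and that they are pairwise distinct.\<close>

fun increasing :: "int \<Rightarrow> int list \<Rightarrow> bool" where
  "increasing x [] \<longleftrightarrow> True"
| "increasing x (y # ys) \<longleftrightarrow> x < y \<and> increasing y ys"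

lemma increasing_distinct: "increasing x ys \<Longrightarrow> distinct ys \<and> (\<forall>y\<in>set ys. x < y)"
  by (induction x ys rule: increasing.induct) auto

lemma certified_keyD:
  assumes "0 < certified_key C fs"
  obtains L where "flips fs grid_triangles = Some L" "C L" "klein_list L" "certified_key C fs = key L"
  using assms klein_list_flips[OF klein_list_grid_triangles]
  by (auto simp: certified_key_def split: option.splits if_splits)

text \<open>The condition depends on the entry because the coordinates, and for symmetric
  realizations the permutation, are part of it.\<close>

lemma card_classes_ge_certified:
  assumes inc: "increasing 0 (map (\<lambda>e. certified_key (C e) (fst e)) es)"
    and Q: "\<And>e L. klein_list L \<Longrightarrow> C e L \<Longrightarrow> Q (complex_of (facets L))"
  shows "length es \<le> card {\<C> \<in> klein_bottle_triangulation_classes 9. \<exists>\<Delta>\<in>\<C>. Q \<Delta>}"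
proof -
  \<comment> \<open>The value of \<open>the\<close> is only used where the key is positive, hence
    where the flip sequence succeeds.\<close>
  define L where "L e = the (flips (fst e) grid_triangles)" for e :: "(nat \<times> nat \<times> nat \<times> nat) list \<times> 'a"
  have L: "C e (L e) \<and> klein_list (L e) \<and> certified_key (C e) (fst e) = key (L e)" if e: "e \<in> set es" for e
  proof -
    have "0 < certified_key (C e) (fst e)" using increasing_distinct[OF inc] e by simp
    then show ?thesis by (rule certified_keyD) (simp add: L_def)
  qed
  have "map (\<lambda>e. certified_key (C e) (fst e)) es = map key (map L es)" using L by simp
  then have "distinct (map key (map L es))" using increasing_distinct[OF inc] by (simp only:)
  moreover have "klein_list M \<and> Q (complex_of (facets M))" if M: "M \<in> set (map L es)" for M
  proof -
    obtain e where e: "e \<in> set es" "M = L e" using M by auto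
    then show ?thesis using L[OF e(1)] Q[of "L e" e] by simp
  qed
  ultimately show ?thesis using card_classes_ge[of "map L es" Q] by simp
qed

text \<open>The coordinates come from a random search; the entries are sorted by key.\<close>

definition realizations :: "((nat \<times> nat \<times> nat \<times> nat) list \<times> point list) list" where
  "realizations = [
    ([],
     [(-1, -6, 0), (-3, 4, -4), (4, -6, -6), (-4, -3, 1), (4, 3, 1), (0, 0, -3), (3, -4, -4), (1, 6, 0), (-4, 6, -6)]),
    ([(0, 3, 4, 2), (4, 7, 3, 8), (2, 6, 7, 0)],
     [(3, -5, 5), (0, -6, 5), (-6, -5, 1), (1, 4, -1), (-4, -4, 1), (2, 2, 1), (1, 5, 6), (-3, -2, -6), (4, -4, -1)]),
    ([(0, 3, 4, 2), (4, 7, 3, 8)],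
     [(0, -14, 11), (-6, 5, 6), (18, -18, -20), (-6, -15, 20), (6, 15, 20), (0, 0, 4), (6, -5, 6), (0, 14, 11), (-18, 18, -20)]),
    ([(0, 3, 4, 2)],
     [(-3, 2, -2), (4, -3, 0), (-5, 0, -5), (-5, 4, -3), (0, -1, 4), (2, -2, 0), (-1, -1, 0), (4, -3, 4), (-1, -2, -4)]),
    ([(3, 4, 0, 7)],
     [(6, 2, 4), (2, -1, -3), (-2, 3, 2), (-6, -5, 5), (6, 5, 5), (0, 0, 2), (-2, 1, -3), (-6, -2, 4), (2, -3, 2)]),
    ([(1, 4, 0, 5)],
     [(1, -1, 0), (5, -2, 1), (-3, -4, -4), (-2, 4, -3), (0, -3, -2), (-4, 1, 6), (1, 2, 5), (4, -6, -5), (-1, 1, -6)]),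
    ([(1, 4, 0, 5), (7, 8, 4, 1)],
     [(0, 1, 2), (6, 2, 0), (-5, -6, 2), (-2, 4, 5), (-1, -1, -1), (0, -4, 5), (2, 1, 4), (3, 1, 1), (-2, 3, 1)]),
    ([(0, 3, 4, 2), (2, 6, 7, 0)],
     [(1, 0, -2), (-1, -1, -2), (-1, 1, 0), (2, 0, 0), (4, -3, 3), (-4, 3, 2), (1, -1, -4), (3, 3, -1), (3, 5, -2)]),
    ([(0, 3, 4, 2), (4, 7, 3, 8), (2, 6, 7, 0), (6, 8, 5, 0)],
     [(2, 3, -3), (2, 2, 1), (1, 3, 4), (-3, 0, 2), (3, 2, 5), (4, -3, -5), (2, 6, 3), (-4, 3, -6), (-2, -3, -1)]),
    ([(0, 3, 4, 2), (4, 7, 3, 8), (1, 2, 5, 7), (6, 8, 5, 0)],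
     [(3, 6, 5), (5, -3, 4), (4, 6, 6), (4, -2, -6), (-4, 2, -6), (0, 0, -1), (-5, 3, 4), (-3, -6, 5), (-4, -6, 6)]),
    ([(0, 3, 4, 2), (2, 7, 6, 1), (4, 8, 5, 7)],
     [(6, 2, 0), (3, -5, -5), (0, -2, 5), (-1, 5, -4), (3, -5, 3), (-1, 4, -3), (-5, 4, -2), (0, 5, -5), (6, 0, -6)]),
    ([(0, 3, 4, 2), (4, 8, 5, 7)],
     [(-1, -1, 5), (1, 0, 2), (0, 5, 0), (-5, -3, 4), (-1, 0, 4), (-2, 0, 2), (-4, 4, 1), (-2, -3, -3), (2, -4, 2)]),
    ([(0, 3, 4, 2), (4, 7, 3, 8), (2, 7, 6, 1)],
     [(1, 0, -2), (-4, -5, -2), (0, 0, 0), (5, -4, -2), (0, 3, 2), (2, 4, 5), (5, -5, -4), (-5, -2, 4), (-1, 3, -1)]),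
    ([(0, 3, 4, 2), (4, 7, 3, 8), (2, 6, 7, 0), (6, 8, 5, 0), (3, 7, 8, 6)],
     [(4, -3, -6), (-2, 2, -6), (0, 1, -3), (0, 1, 2), (2, 0, -4), (2, 3, 3), (1, 5, 3), (-5, -3, 0), (-4, -5, -1)]),
    ([(0, 3, 4, 2), (2, 6, 7, 0), (6, 7, 3, 0)],
     [(1, -1, 4), (-4, -3, 3), (2, 0, -2), (5, 0, -6), (-6, -3, -6), (-1, 2, 3), (-4, -4, 6), (3, 4, 0), (4, 5, 0)]),
    ([(0, 3, 4, 2), (4, 7, 3, 8), (0, 2, 4, 6)],
     [(-6, -6, -2), (-3, -2, 1), (4, -5, 5), (1, 2, -5), (4, -1, 1), (0, -2, 1), (1, -2, 1), (-2, 3, -2), (0, 0, 5)]),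
    ([(0, 3, 4, 2), (4, 7, 3, 8), (1, 2, 5, 7), (0, 4, 2, 1)],
     [(6, -6, -3), (4, 3, 3), (-2, -5, -5), (3, -3, 6), (6, -6, 4), (3, -2, 3), (-4, -5, 1), (3, 3, 4), (6, 1, 6)]),
    ([(1, 4, 0, 5), (2, 6, 7, 0)],
     [(0, 0, 9), (20, 17, 20), (-20, -17, 20), (9, 8, 16), (-5, 5, 5), (17, -12, -12), (5, -5, 5), (-17, 12, -12), (-9, -8, 16)]),
    ([(1, 4, 0, 5), (2, 6, 7, 0), (7, 8, 4, 1)],
     [(0, 1, 2), (5, 3, 6), (-4, -4, 5), (2, 2, 4), (-2, 3, 1), (6, -4, -3), (2, -2, 0), (-4, 5, -1), (-2, -2, 4)]),
    ([(0, 3, 4, 2), (0, 8, 1, 6)],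
     [(0, 0, 2), (5, -5, 4), (-5, 5, 4), (3, -2, 2), (4, 2, -4), (-6, -3, -6), (-4, -2, -4), (6, 3, -6), (-3, 2, 2)]),
    ([(0, 3, 4, 2), (2, 6, 7, 0), (5, 8, 4, 6)],
     [(1, -3, -2), (1, 0, 0), (6, -6, 6), (2, -2, 6), (-1, 5, -5), (-1, 1, 1), (2, -5, -4), (-6, 4, -2), (-2, 2, -5)]),
    ([(3, 4, 0, 7), (1, 2, 5, 7)],
     [(-4, -3, 2), (5, -3, 5), (2, -6, 6), (-5, 3, 5), (-2, 6, 6), (4, 3, 2), (3, -2, -5), (0, 0, -1), (-3, 2, -5)]),
    ([(0, 3, 4, 2), (2, 6, 7, 0), (4, 8, 5, 7)],
     [(-4, -3, -2), (-2, 1, -4), (-1, 3, -1), (6, -2, 3), (5, 4, -1), (-6, 6, -2), (-2, -6, -6), (-6, 1, 3), (-5, -3, -4)]),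
    ([(0, 3, 4, 2), (3, 7, 4, 6), (2, 6, 7, 0)],
     [(5, 0, -4), (-3, 4, -1), (2, -2, -3), (5, -4, -2), (-5, -2, -1), (-3, -5, 5), (3, -4, -1), (1, -2, -1), (0, -5, 2)]),
    ([(0, 3, 4, 2), (2, 6, 7, 0), (5, 6, 8, 3)],
     [(-4, 5, 5), (-4, 3, 1), (0, 1, 1), (1, 0, -2), (4, -4, 5), (0, -4, 4), (-2, 5, 5), (1, -1, -4), (-2, -6, 6)]),
    ([(0, 3, 4, 2), (2, 6, 7, 0), (6, 7, 3, 0), (4, 8, 5, 7)],
     [(2, 2, -4), (-4, -5, 4), (-1, -3, 4), (-1, 4, 6), (-3, 0, 6), (2, -4, 5), (-5, -6, 1), (4, -3, 5), (6, -6, -5)]),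
    ([(0, 3, 4, 2), (2, 6, 7, 0), (1, 2, 5, 7), (0, 4, 2, 1)],
     [(-4, 6, -5), (-2, -3, -6), (2, 6, 6), (-1, 5, 1), (-2, 3, 2), (-6, 0, 1), (-2, 3, -4), (2, -2, -6), (-2, -1, -6)]),
    ([(0, 3, 4, 2), (1, 2, 5, 7), (6, 8, 5, 0)],
     [(2, 0, 2), (-5, -5, 3), (-1, 6, 6), (4, -5, 3), (5, -3, -6), (-1, -2, 1), (1, -2, -2), (-3, -5, -3), (-6, -1, -4)]),
    ([(0, 3, 4, 2), (1, 2, 5, 7), (0, 4, 2, 1)],
     [(-4, 1, 3), (5, -5, -4), (0, 4, -1), (0, 2, 0), (3, 0, -1), (3, 4, 0), (-2, 2, 0), (-3, 5, -3), (-3, 1, 1)]),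
    ([(0, 3, 4, 2), (3, 7, 4, 6), (2, 6, 7, 0), (1, 2, 5, 7), (0, 4, 2, 1)],
     [(2, 5, 0), (3, 3, -5), (5, -2, -2), (-1, 2, 2), (3, -6, -3), (1, 0, -5), (-6, -4, 4), (2, 0, -4), (-4, -5, 0)]),
    ([(0, 3, 4, 2), (2, 6, 7, 0), (1, 2, 5, 7)],
     [(0, 0, 1), (1, 3, 0), (-3, -4, -2), (-2, -1, 6), (-1, 1, -2), (2, -6, -6), (2, -2, 6), (0, 4, -5), (-2, 2, -2)]),
    ([(0, 3, 4, 2), (0, 2, 4, 6)],
     [(-5, 3, -4), (0, 4, -4), (-6, 0, 3), (3, -5, -1), (4, -6, 0), (0, 0, -2), (0, 1, 0), (6, 2, -2), (3, 4, -1)]),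
    ([(3, 4, 0, 7), (1, 4, 5, 0)],
     [(5, 4, -2), (-5, -2, 6), (4, -4, 0), (1, 5, 6), (-5, 2, -3), (0, -2, 1), (6, 0, -6), (-6, 1, -1), (0, -6, 5)]),
    ([(0, 3, 4, 2), (4, 8, 5, 7), (0, 1, 8, 4)],
     [(5, -5, -6), (-5, 1, -3), (-5, -2, -6), (4, -3, 6), (0, 1, -2), (-1, 0, 0), (-6, -5, 4), (-3, 6, 6), (-1, 6, -1)]),
    ([(0, 3, 4, 2), (1, 2, 5, 7), (5, 8, 4, 6), (4, 5, 1, 6)],
     [(4, -3, -2), (-4, -4, 0), (4, 4, 0), (6, -6, -1), (0, 3, -5), (-4, 3, -2), (0, 0, -3), (0, -3, -5), (-6, 6, -1)]),
    ([(0, 3, 4, 2), (2, 6, 7, 0), (6, 8, 5, 0)],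
     [(-4, -1, -1), (0, -4, -5), (0, -2, -1), (-3, 2, 5), (4, -3, 0), (2, -1, -5), (-5, -6, -6), (-5, 5, 5), (3, 6, 0)]),
    ([(0, 3, 4, 2), (2, 6, 7, 0), (4, 8, 5, 7), (0, 1, 8, 4)],
     [(-5, -4, 5), (-3, 0, 2), (-3, 2, 2), (6, -2, 6), (-3, -3, 5), (3, -5, -1), (4, 0, 6), (-6, -6, 5), (4, -4, -6)]),
    ([(1, 4, 0, 5), (7, 8, 4, 1), (4, 7, 3, 1)],
     [(-4, 3, -1), (1, 3, 0), (4, 5, -1), (-1, 4, 3), (3, -4, 1), (1, 3, -4), (1, 3, -5), (3, -2, -5), (5, 5, 1)]),
    ([(0, 3, 4, 2), (2, 6, 7, 0), (1, 2, 5, 7), (0, 4, 2, 1), (5, 6, 8, 3)],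
     [(-4, -2, -2), (4, 2, -2), (-1, -1, -3), (3, -4, 0), (3, -3, 1), (-1, -2, -2), (2, -5, -4), (4, 1, 1), (-6, -1, 0)]),
    ([(0, 3, 4, 2), (1, 8, 0, 7), (4, 8, 5, 7)],
     [(-3, 5, 1), (6, -2, -1), (3, -1, -2), (-3, -2, -2), (1, 1, 0), (-4, 0, 1), (-1, -5, -5), (-5, 6, -6), (-5, -3, 2)]),
    ([(0, 3, 4, 2), (4, 7, 3, 8), (3, 4, 2, 8)],
     [(5, 2, -6), (-1, -2, -2), (6, 5, 3), (1, -3, -5), (-1, 3, -5), (0, 0, -3), (1, 2, -2), (-5, -2, -6), (-6, -5, 3)]),
    ([(0, 3, 4, 2), (2, 6, 7, 0), (5, 8, 4, 6), (4, 5, 1, 6)],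
     [(3, 0, -3), (2, -1, -1), (3, -3, -2), (4, 0, -4), (6, 2, -3), (-4, -4, 0), (6, 4, 1), (0, 2, -1), (1, 6, 4)]),
    ([(0, 3, 4, 2), (0, 2, 4, 6), (4, 8, 5, 7)],
     [(-2, 5, 1), (-6, -6, -3), (-1, -5, 4), (1, 0, 1), (-1, 2, 3), (1, 0, -1), (5, -1, 5), (6, 0, -3), (-4, -2, -6)]),
    ([(0, 3, 4, 2), (4, 7, 3, 8), (0, 2, 4, 6), (7, 8, 3, 1)],
     [(5, 2, 3), (1, -2, 1), (4, 6, 3), (5, -1, -6), (-5, 1, -6), (0, 0, 2), (-1, 2, 1), (-5, -2, 3), (-4, -6, 3)]),
    ([(0, 3, 4, 2), (2, 7, 6, 1), (0, 2, 4, 6), (6, 8, 5, 0)],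
     [(-6, 3, 6), (-1, 3, 1), (-3, 2, -5), (-6, 3, 5), (1, -4, 6), (1, 4, 4), (3, 0, 5), (-3, 2, -3), (-1, 6, -5)]),
    ([(0, 3, 4, 2), (4, 8, 5, 7), (6, 8, 5, 0)],
     [(-2, -1, -1), (4, 5, -1), (-2, -2, 6), (2, -4, 2), (-2, 0, -1), (-5, -2, 3), (-6, 1, -4), (4, 1, 2), (5, -3, 4)]),
    ([(0, 3, 4, 2), (2, 7, 6, 1), (3, 4, 2, 7), (4, 8, 5, 7)],
     [(3, 4, -1), (-6, 6, 5), (4, -5, 6), (4, 1, -5), (-6, 5, 0), (-4, -4, 0), (1, 1, 2), (1, -2, 2), (-3, 4, 1)]),
    ([(0, 3, 4, 2), (2, 6, 7, 0), (1, 2, 5, 7), (5, 6, 8, 3)],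
     [(-3, -3, 6), (1, 5, 4), (-4, -5, -2), (-1, -6, -5), (-6, -5, -4), (-4, -1, -2), (-5, -6, 4), (4, 0, -6), (-2, 3, -2)]),
    ([(0, 3, 4, 2), (3, 7, 4, 6), (1, 2, 5, 7), (0, 4, 2, 1)],
     [(-2, -6, 2), (-1, 0, -6), (0, 1, 5), (-6, -3, 1), (-1, 0, -1), (-6, 1, -6), (6, -3, 4), (6, 3, 6), (-1, -1, -4)]),
    ([(0, 3, 4, 2), (3, 7, 4, 6), (2, 6, 7, 0), (1, 2, 5, 7)],
     [(-6, -6, 1), (2, -2, 5), (-3, 4, -6), (3, 0, 3), (6, -3, -2), (5, 6, 4), (1, 6, -5), (0, 4, 0), (2, 5, -6)]),
    ([(0, 3, 4, 2), (1, 2, 5, 7), (0, 2, 4, 6), (6, 8, 5, 0)],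
     [(0, 1, 0), (3, -3, -5), (5, 4, 0), (0, -4, 3), (-5, -1, 5), (0, -1, -1), (-5, 1, 3), (-5, -1, -3), (-6, 3, -4)]),
    ([(0, 3, 4, 2), (2, 6, 7, 0), (6, 7, 3, 0), (0, 6, 3, 8)],
     [(1, 2, -1), (2, 0, -1), (1, -2, 1), (0, -2, 4), (-5, -2, 2), (-1, -3, 1), (6, -6, -2), (3, 2, 1), (-1, 4, -3)]),
    ([(0, 3, 4, 2), (3, 7, 4, 6), (2, 6, 7, 0), (3, 4, 2, 6)],
     [(2, 6, 5), (5, 0, -5), (-4, 3, 6), (-4, 4, -3), (-6, -4, 1), (0, 0, -6), (-4, 2, -6), (-1, 5, 5), (-3, 1, -3)]),
    ([(0, 3, 4, 2), (4, 7, 3, 8), (2, 7, 6, 1), (0, 2, 4, 6)],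
     [(5, 1, -3), (6, 3, -3), (2, 6, -2), (2, 5, 4), (2, 2, -3), (-1, 2, -4), (5, 1, 0), (5, 5, -3), (3, 0, -4)]),
    ([(0, 3, 4, 2), (4, 7, 3, 8), (3, 4, 2, 8), (2, 7, 6, 1)],
     [(4, -3, -4), (0, -1, 2), (3, 0, -4), (-6, -4, 0), (3, 3, -5), (-6, -4, -4), (-5, -4, 0), (2, 2, 6), (5, -1, -6)]),
    ([(0, 3, 4, 2), (3, 7, 4, 6), (1, 8, 0, 7), (4, 5, 1, 8), (2, 3, 4, 5)],
     [(2, 4, 5), (1, 3, 4), (2, 2, 2), (3, 4, 0), (4, -1, 1), (-5, 0, -2), (4, 2, -4), (2, 1, -4), (-5, -2, -3)]),
    ([(0, 3, 4, 2), (2, 7, 6, 1), (0, 2, 4, 6)],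
     [(1, -2, 1), (2, 1, 2), (1, 4, 1), (-5, -5, -3), (-2, -1, 5), (3, 1, 2), (2, 0, 5), (0, 1, 1), (6, 4, 0)]),
    ([(0, 3, 4, 2), (2, 6, 7, 0), (6, 7, 3, 0), (5, 6, 8, 3)],
     [(1, 0, 4), (1, -1, 2), (3, 4, -4), (5, 6, -6), (-4, -3, 1), (-4, -5, 3), (-4, 1, 4), (6, -6, 1), (1, -5, 2)]),
    ([(0, 3, 4, 2), (2, 7, 6, 1), (6, 7, 3, 1), (1, 7, 3, 8)],
     [(1, -1, -4), (2, -1, 0), (3, 2, 1), (-3, 3, -1), (5, -2, 5), (-2, -5, 3), (-1, -4, -2), (5, 4, 0), (5, -5, 1)]),
    ([(0, 3, 4, 2), (2, 6, 7, 0), (1, 2, 5, 7), (2, 7, 5, 0)],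
     [(2, 0, -2), (-3, -5, 1), (3, 1, -1), (-2, 6, -6), (-1, -4, 6), (2, -3, -6), (5, 4, -5), (1, 3, 3), (5, 5, 6)]),
    ([(0, 3, 4, 2), (2, 6, 7, 0), (4, 8, 5, 7), (0, 1, 8, 4), (0, 4, 2, 8)],
     [(2, 1, 1), (-5, -4, 2), (-6, -5, -2), (3, 6, -2), (1, 1, 0), (6, 6, 3), (-6, 1, -6), (6, -6, -2), (-1, -2, 6)]),
    ([(0, 3, 4, 2), (2, 6, 7, 0), (1, 2, 5, 7), (2, 7, 5, 0), (5, 6, 8, 3)],
     [(3, 2, -4), (2, 1, -1), (-6, 5, 2), (-5, -2, 3), (-5, 5, 5), (-4, 1, 1), (2, 2, -6), (4, -4, 6), (1, 4, 6)]),
    ([(0, 3, 4, 2), (0, 2, 4, 6), (3, 6, 7, 5)],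
     [(-6, 4, 2), (-1, -3, 2), (3, 4, 6), (-3, 6, -6), (4, -5, -6), (-2, 2, 1), (-1, 3, -1), (1, -6, -2), (5, -6, 5)]),
    ([(0, 3, 4, 2), (4, 7, 3, 8), (2, 7, 6, 1), (6, 7, 3, 1)],
     [(1, 0, -1), (0, 1, 2), (-6, -4, 3), (-5, -6, 5), (-4, -4, 0), (-6, -6, -5), (6, -1, -1), (-4, 6, -1), (1, 0, -6)]),
    ([(3, 4, 0, 7), (1, 2, 5, 7), (6, 8, 5, 0)],
     [(5, 4, -5), (-4, -6, -3), (1, -1, 6), (-1, -4, -6), (1, 4, -6), (0, 0, -3), (4, 6, -3), (-5, -4, -5), (-1, 1, 6)]),
    ([(0, 3, 4, 2), (1, 2, 5, 7), (0, 4, 2, 1), (0, 2, 1, 6)],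
     [(-1, 5, 6), (0, 0, 1), (-4, -2, 5), (2, -3, 2), (3, -2, 3), (4, -4, -2), (-2, -2, 6), (-1, -5, 2), (6, -6, -5)]),
    ([(0, 3, 4, 2), (0, 2, 4, 6), (1, 7, 2, 8), (1, 8, 0, 2)],
     [(2, -6, 0), (4, 4, 4), (-6, 5, -1), (-3, -5, 2), (-2, -5, -1), (-3, -6, 6), (3, 3, -1), (0, 5, 2), (0, -2, 0)]),
    ([(0, 3, 4, 2), (2, 6, 7, 0), (6, 7, 3, 0), (6, 8, 5, 0)],
     [(-2, 3, 0), (1, 0, 1), (3, -2, -1), (1, 2, -5), (5, -6, -6), (6, -2, 6), (-6, 4, 3), (2, 3, -2), (5, 0, 5)]),
    ([(0, 3, 4, 2), (1, 2, 5, 7), (0, 4, 2, 1), (0, 8, 1, 6)],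
     [(-4, 3, -2), (-4, -4, 0), (4, -3, -3), (-2, 0, -1), (1, -2, -1), (3, -3, 5), (-5, 3, -4), (5, -5, -5), (-5, 0, -4)]),
    ([(0, 3, 4, 2), (2, 7, 6, 1), (6, 7, 3, 1), (5, 8, 4, 6), (4, 8, 6, 7)],
     [(-2, -5, -6), (1, 5, 5), (-3, 4, -6), (-2, -4, -1), (1, 4, -1), (-1, 2, -2), (-4, -2, 5), (-1, 2, 3), (-2, 2, 1)]),
    ([(0, 3, 4, 2), (2, 6, 7, 0), (4, 8, 5, 7), (6, 8, 5, 0)],
     [(2, 0, -4), (1, 4, 2), (0, 6, 3), (-6, 0, 1), (3, 3, 6), (2, -5, 5), (3, 5, -3), (-6, -1, 1), (-1, -6, 1)]),
    ([(0, 3, 4, 2), (2, 6, 7, 0), (5, 6, 8, 3), (3, 5, 8, 2)],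
     [(-1, 0, -4), (-2, 2, -1), (-2, 2, 1), (-3, -4, -4), (1, 1, 4), (4, 3, 2), (6, 0, -2), (-6, -2, -4), (-3, 5, 3)]),
    ([(0, 3, 4, 2), (3, 7, 4, 6), (2, 6, 7, 0), (1, 2, 5, 7), (6, 8, 5, 0)],
     [(-2, 1, -4), (3, -4, -4), (-3, 5, 1), (2, -1, -3), (-3, -2, 2), (5, -1, 3), (-2, -1, 1), (3, 4, -1), (1, 1, 0)]),
    ([(0, 3, 4, 2), (4, 7, 3, 8), (1, 2, 5, 7), (0, 6, 2, 8), (0, 8, 1, 2)],
     [(-4, -2, -4), (5, -5, -5), (6, 2, 6), (-2, -5, 0), (-5, -3, -3), (6, -6, 3), (2, 2, 1), (6, 4, -4), (3, 0, -2)]),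
    ([(0, 3, 4, 2), (4, 8, 5, 7), (0, 1, 8, 4), (0, 4, 2, 8)],
     [(-2, 0, 1), (4, -5, -3), (-5, -5, 3), (1, 3, -1), (1, 0, -1), (3, 3, -2), (2, -1, 4), (-5, 2, 0), (5, 5, -5)]),
    ([(0, 3, 4, 2), (1, 8, 0, 7), (4, 8, 5, 7), (7, 8, 5, 0)],
     [(-5, 2, 5), (2, 5, 2), (0, 3, -1), (0, 1, 0), (1, 0, 2), (-1, -2, -2), (-1, 3, -3), (-2, 3, -3), (4, -3, 5)]),
    ([(0, 3, 4, 2), (1, 2, 5, 7), (0, 4, 2, 1), (0, 1, 2, 8)],
     [(6, 6, 3), (5, 1, -3), (6, 6, 2), (1, -3, 6), (2, -3, 0), (2, 2, 2), (-2, 1, 3), (-4, -1, 1), (5, -4, -6)]),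
    ([(0, 3, 4, 2), (0, 2, 4, 6), (4, 8, 5, 7), (0, 1, 8, 4)],
     [(-4, 4, 0), (3, -1, 5), (6, 2, 4), (-3, 4, -1), (-3, 3, 0), (0, 1, -1), (6, 5, 3), (4, -2, -4), (-6, -6, -6)]),
    ([(0, 3, 4, 2), (4, 7, 3, 8), (1, 2, 5, 7), (0, 4, 2, 1), (0, 6, 2, 8)],
     [(-4, -6, -4), (3, 4, 2), (5, -5, 3), (3, -2, 3), (-1, -2, 5), (-2, -4, 6), (6, -2, -3), (5, -1, 3), (-1, -5, -3)]),
    ([(0, 3, 4, 2), (3, 7, 4, 6), (2, 6, 7, 0), (1, 2, 5, 7), (2, 7, 5, 0)],
     [(0, -4, -2), (3, -5, -2), (-5, -3, -1), (4, -3, 5), (-4, 2, -5), (5, 5, -3), (2, 1, 4), (1, -2, -2), (4, 0, 2)]),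
    ([(0, 3, 4, 2), (1, 2, 5, 7), (0, 4, 2, 1), (0, 6, 2, 8)],
     [(6, 4, -1), (3, -6, -4), (-3, 5, 3), (1, 3, 2), (3, -2, -1), (2, 2, 6), (2, 3, -3), (-6, -1, -6), (6, 3, -4)]),
    ([(0, 3, 4, 2), (4, 7, 3, 8), (3, 4, 2, 8), (2, 7, 6, 1), (6, 7, 3, 1)],
     [(-3, 1, 0), (-4, 1, -4), (0, 0, 0), (-3, -4, -3), (4, 5, 2), (4, -2, 2), (-2, 0, 3), (3, 4, -5), (3, 5, 5)]),
    ([(0, 3, 4, 2), (0, 2, 4, 6), (4, 8, 5, 7), (0, 4, 1, 6)],
     [(-5, 0, -4), (-2, 5, 4), (2, 5, 5), (-5, -4, -4), (-4, 0, 0), (-2, -1, 0), (5, 2, -4), (-3, -5, 2), (-5, -2, 4)]),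
    ([(0, 3, 4, 2), (2, 6, 7, 0), (5, 8, 4, 6), (4, 5, 1, 6), (1, 5, 2, 6)],
     [(1, 0, -5), (1, 2, 3), (6, 4, 5), (5, -3, -6), (-1, -2, 5), (2, 6, -2), (-2, 0, 5), (-3, 1, 0), (-3, 1, 2)]),
    ([(0, 3, 4, 2), (2, 6, 7, 0), (6, 7, 3, 0), (4, 8, 5, 7), (3, 6, 0, 5)],
     [(1, -3, 0), (-3, -1, 5), (-2, -3, 3), (-1, 3, -2), (-2, 2, 4), (-2, 4, -3), (-4, 2, -2), (5, 5, 5), (0, 5, 4)]),
    ([(0, 3, 4, 2), (2, 6, 7, 0), (6, 8, 5, 0), (0, 6, 5, 7)],
     [(1, 1, 4), (-2, 5, -4), (-1, 3, -3), (6, -3, 6), (5, 0, -3), (-3, 1, -3), (1, 3, 5), (3, -5, 6), (0, -2, 1)]),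
    ([(0, 3, 4, 2), (3, 7, 4, 6), (2, 7, 6, 1), (6, 8, 5, 0), (1, 7, 6, 8)],
     [(-6, 4, 0), (-5, -3, 4), (-2, -1, 0), (3, 1, -3), (2, -3, -3), (6, -1, -1), (-1, 1, -2), (2, -4, -3), (5, -5, 5)]),
    ([(0, 3, 4, 2), (3, 7, 4, 6), (1, 2, 5, 7), (0, 4, 2, 1), (0, 1, 2, 8)],
     [(-6, -1, 6), (0, 2, -2), (0, 0, 4), (-5, -2, 0), (-5, 2, -6), (-1, 1, -3), (2, -3, -2), (3, 1, -3), (-1, 5, -5)]),
    ([(0, 3, 4, 2), (3, 7, 4, 6), (1, 2, 5, 7), (0, 8, 1, 6), (0, 6, 1, 2)],
     [(1, 1, 5), (-5, -5, 2), (2, 5, 3), (-3, 1, 2), (0, 2, 4), (-4, 5, 2), (-1, -1, 3), (3, -3, -5), (-2, -4, 3)]),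
    ([(0, 3, 4, 2), (3, 7, 4, 6), (2, 7, 6, 1), (6, 8, 5, 0), (4, 7, 6, 8)],
     [(-4, 0, 0), (-3, -5, -1), (-6, -6, 3), (6, -3, 0), (-2, -2, 0), (4, -1, -3), (5, -4, 5), (-4, -6, -3), (-6, 1, -2)])]"

text \<open>Eleven entries of \<open>realizations\<close>, with the same coordinates and the vertex
  permutation of the half-turn. As nine is odd, an involution fixes a vertex, which lies on the
  axis; here it is exactly one in every entry.\<close>

definition symmetric_realizations :: "((nat \<times> nat \<times> nat \<times> nat) list \<times> point list \<times> nat list) list" where
  "symmetric_realizations = [
    ([],
     [(-1, -6, 0), (-3, 4, -4), (4, -6, -6), (-4, -3, 1), (4, 3, 1), (0, 0, -3), (3, -4, -4), (1, 6, 0), (-4, 6, -6)], [7, 6, 8, 4, 3, 5, 1, 0, 2]),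
    ([(0, 3, 4, 2), (4, 7, 3, 8)],
     [(0, -14, 11), (-6, 5, 6), (18, -18, -20), (-6, -15, 20), (6, 15, 20), (0, 0, 4), (6, -5, 6), (0, 14, 11), (-18, 18, -20)], [7, 6, 8, 4, 3, 5, 1, 0, 2]),
    ([(3, 4, 0, 7)],
     [(6, 2, 4), (2, -1, -3), (-2, 3, 2), (-6, -5, 5), (6, 5, 5), (0, 0, 2), (-2, 1, -3), (-6, -2, 4), (2, -3, 2)], [7, 6, 8, 4, 3, 5, 1, 0, 2]),
    ([(0, 3, 4, 2), (4, 7, 3, 8), (1, 2, 5, 7), (6, 8, 5, 0)],
     [(3, 6, 5), (5, -3, 4), (4, 6, 6), (4, -2, -6), (-4, 2, -6), (0, 0, -1), (-5, 3, 4), (-3, -6, 5), (-4, -6, 6)], [7, 6, 8, 4, 3, 5, 1, 0, 2]),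
    ([(1, 4, 0, 5), (2, 6, 7, 0)],
     [(0, 0, 9), (20, 17, 20), (-20, -17, 20), (9, 8, 16), (-5, 5, 5), (17, -12, -12), (5, -5, 5), (-17, 12, -12), (-9, -8, 16)], [0, 2, 1, 8, 6, 7, 4, 5, 3]),
    ([(0, 3, 4, 2), (0, 8, 1, 6)],
     [(0, 0, 2), (5, -5, 4), (-5, 5, 4), (3, -2, 2), (4, 2, -4), (-6, -3, -6), (-4, -2, -4), (6, 3, -6), (-3, 2, 2)], [0, 2, 1, 8, 6, 7, 4, 5, 3]),
    ([(3, 4, 0, 7), (1, 2, 5, 7)],
     [(-4, -3, 2), (5, -3, 5), (2, -6, 6), (-5, 3, 5), (-2, 6, 6), (4, 3, 2), (3, -2, -5), (0, 0, -1), (-3, 2, -5)], [5, 3, 4, 1, 2, 0, 8, 7, 6]),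
    ([(0, 3, 4, 2), (1, 2, 5, 7), (5, 8, 4, 6), (4, 5, 1, 6)],
     [(4, -3, -2), (-4, -4, 0), (4, 4, 0), (6, -6, -1), (0, 3, -5), (-4, 3, -2), (0, 0, -3), (0, -3, -5), (-6, 6, -1)], [5, 2, 1, 8, 7, 0, 6, 4, 3]),
    ([(0, 3, 4, 2), (4, 7, 3, 8), (3, 4, 2, 8)],
     [(5, 2, -6), (-1, -2, -2), (6, 5, 3), (1, -3, -5), (-1, 3, -5), (0, 0, -3), (1, 2, -2), (-5, -2, -6), (-6, -5, 3)], [7, 6, 8, 4, 3, 5, 1, 0, 2]),
    ([(0, 3, 4, 2), (4, 7, 3, 8), (0, 2, 4, 6), (7, 8, 3, 1)],
     [(5, 2, 3), (1, -2, 1), (4, 6, 3), (5, -1, -6), (-5, 1, -6), (0, 0, 2), (-1, 2, 1), (-5, -2, 3), (-4, -6, 3)], [7, 6, 8, 4, 3, 5, 1, 0, 2]),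
    ([(3, 4, 0, 7), (1, 2, 5, 7), (6, 8, 5, 0)],
     [(5, 4, -5), (-4, -6, -3), (1, -1, 6), (-1, -4, -6), (1, 4, -6), (0, 0, -3), (4, 6, -3), (-5, -4, -5), (-1, 1, 6)], [7, 6, 8, 4, 3, 5, 1, 0, 2])]"

text \<open>Evaluation by rewriting with the code equations, so the integer arithmetic is checked by
  the kernel. The early exit in \<open>separated\<close> spares two determinants whenever the first
  two already separate the cones.\<close>

lemma realizations_certified:
  "increasing 0 (map (\<lambda>e. certified_key (realizes (snd e)) (fst e)) realizations)"
  by code_simp

lemma symmetric_realizations_certified:
  "increasing 0 (map (\<lambda>e. certified_key
     (\<lambda>L. realizes (fst (snd e)) L \<and> rotation_symmetric (snd (snd e)) (fst (snd e)) L) (fst e)) symmetric_realizations)"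
  by code_simp

theorem theorem5p2:
  shows "card {C \<in> klein_bottle_triangulation_classes 9.
                 \<exists>\<Delta>\<in>C. polyhedrally_realizable \<Delta>} \<ge> 90
       \<and> card {C \<in> klein_bottle_triangulation_classes 9.
                 \<exists>\<Delta>\<in>C. \<exists>\<psi>. polyhedral_realization \<Delta> \<psi> \<and>
                              has_twofold_rotational_symmetry \<Delta> \<psi>} \<ge> 11"
proof
  have "length realizations = 90" by (simp add: realizations_def)
  moreover have "polyhedrally_realizable (complex_of (facets L))" if "klein_list L" "realizes (snd e) L"
    for L and e :: "(nat \<times> nat \<times> nat \<times> nat) list \<times> point list"
    using klein_list_realization[OF that] unfolding polyhedrally_realizable_def by blast
  ultimately show "card {C \<in> klein_bottle_triangulation_classes 9. \<exists>\<Delta>\<in>C. polyhedrally_realizable \<Delta>} \<ge> 90"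
    using card_classes_ge_certified[OF realizations_certified, of polyhedrally_realizable] by simp
next
  let ?Q = "\<lambda>\<Delta>. \<exists>\<psi>. polyhedral_realization \<Delta> \<psi> \<and> has_twofold_rotational_symmetry \<Delta> \<psi>"
  have "length symmetric_realizations = 11" by (simp add: symmetric_realizations_def)
  moreover have "?Q (complex_of (facets L))"
    if "klein_list L" "realizes (fst (snd e)) L \<and> rotation_symmetric (snd (snd e)) (fst (snd e)) L"
    for L and e :: "(nat \<times> nat \<times> nat \<times> nat) list \<times> point list \<times> nat list"
    using that klein_list_realization twofold_rotational_symmetry by blast
  ultimately show "card {C \<in> klein_bottle_triangulation_classes 9. \<exists>\<Delta>\<in>C. ?Q \<Delta>} \<ge> 11"
    using card_classes_ge_certified[OF symmetric_realizations_certified, of ?Q] by simp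
qed

end
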